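(* Let $Z_p$, $\mathcal I_B$, $\mathfrak F$, $\mathcal I(c)$ and $\mathfrak F_+$ be as defined in the context. Then $\mathcal I(c)\cong\mathcal I(d)$ for any non-zero sequences $c,d\in\ell^1$, and $\mathcal I(c)\cong\mathcal I_{\{j\}}$ for any non-zero $c\in\ell^1$ and any $j\in\mathrm{supp}(c)$. In addition, if the component space $X$ in the definition of $Z_p$ satisfies the linear isomorphism condition $$\Big(\bigoplus_{j\in\mathbb N}X\Big)_{\ell^p}\approx X,$$ then $$\mathcal I(c)\cong\mathcal I_B\quad\text{for any }\mathcal I(c)\in\mathfrak F_+\text{ and }\mathcal I_B\in\mathfrak F.$$
   Context: Scalars are real or complex; $\mathbb N=\{1,2,\ldots\}$, $\mathbb N_0=\mathbb N\cup\{0\}$. $E\approx F$ means linearly isomorphic (linearly homeomorphic) Banach spaces; $\mathcal A\cong\mathcal B$ means that the Banach algebras are isomorphic, i.e. there is a multiplicative linear homeomorphism of $\mathcal A$ onto $\mathcal B$. For Banach spaces $E,F$: $\mathcal K(E,F)$ are the compact operators; $\mathcal A(E,F)$ is the operator-norm closure of the bounded finite-rank operators (the approximable operators); $\mathcal K(E)=\mathcal K(E,E)$, etc. A.P. is the approximation property. The space $Z_p$: let $X$ be a Banach space such that $X$ has the A.P. but $X^*$ fails the A.P., and let $Y$ be a Banach space such that $\mathcal A(X,Y)\subsetneq\mathcal K(X,Y)$ (such a $Y$ exists). Fix $1<p<\infty$ and put $$Z_p=\Big(\bigoplus_{j=0}^\infty X_j\Big)_{\ell^p},\qquad X_0=Y,\quad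 X_j=X\ (j\ge1).$$ Let $P_j:Z_p\to X_j$ and $J_k:X_k\to Z_p$ be the natural projections and inclusions, and for $S\in\mathcal L(Z_p)$ write $S=[S_{jk}]$ with $S_{jk}=P_jSJ_k\in\mathcal L(X_k,X_j)$, $j,k\in\mathbb N_0$. For $\emptyset\ne B\subsetneq\mathbb N$ put $$\mathcal I_B=\{S=[S_{jk}]\in\mathcal K(Z_p): S_{00}\in\mathcal A(Y),\ S_{0k}\in\mathcal A(X,Y)\text{ for }k\in B\},$$ and $\mathfrak F=\{\mathcal I_B:\emptyset\neq B\subsetneq\mathbb N\}$. For a non-zero sequence $c=(c_j)_{j\in\mathbb N}\in\ell^1$ let $\mathrm{supp}(c)=\{j\in\mathbb N:c_j\ne0\}$ and $$\mathcal I(c)=\Big\{S=[S_{jk}]\in\mathcal K(Z_p): S_{00}\in\mathcal A(Y)\text{ and } x\mapsto\sum_{r=1}^\infty c_rS_{0r}x\text{ is an approximable operator }X\to Y\Big\}.$$ Put $\mathfrak F_+=\{\mathcal I(c):c\in\ell^1,\ \#(\mathrm{supp}(c))\ge2\}$. All the sets $\mathcal I_B$ and $\mathcal I(c)$ are closed subalgebras of $\mathcal L(Z_p)$. *)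

theory Defs
  imports "HOL-Analysis.Analysis" "HOL-Library.Function_Algebras"
begin

section \<open>Normed spaces with explicit carrier, scalars and norm\<close>

text \<open>
  The norm of an \<open>\<ell>\<^sup>p\<close>-sum depends on the number \<open>p\<close>, and dual spaces depend on the scalar field, so
  these spaces cannot be types of class \<open>banach\<close>.  A normed space is therefore given by a linear
  subspace \<open>carr\<close> of an ambient vector space (the whole type \<open>'v\<close> with \<open>scal\<close>) and a norm,
  meaningful on \<open>carr\<close> only.

  The scalar field is any type \<open>'k\<close> of class \<open>real_normed_field\<close>.  By the Gelfand-Mazur theorem such
  a field is isometrically isomorphic to the real or to the complex numbers.
\<close>

record ('k, 'v) nspace =
  carr :: "'v set"
  scal :: "'k \<Rightarrow> 'v \<Rightarrow> 'v"
  nrm  :: "'v \<Rightarrow> real"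

text \<open>The library locale \<open>Metric_space\<close> wants symmetry and non-negativity on the whole type;
  hence the default value off the carrier.\<close>

definition ndist :: "('k, 'v::ab_group_add) nspace \<Rightarrow> 'v \<Rightarrow> 'v \<Rightarrow> real" where
  "ndist E x y = (if x \<in> carr E \<and> y \<in> carr E then nrm E (x - y) else 0)"

definition ntop :: "('k, 'v::ab_group_add) nspace \<Rightarrow> 'v topology" where
  "ntop E = Metric_space.mtopology (carr E) (ndist E)"

locale normed_space = vector_space "scal E"
  for E :: "('k::real_normed_field, 'v::ab_group_add) nspace" +
  assumes carr_subspace: "subspace (carr E)"
    and nrm_nonneg: "x \<in> carr E \<Longrightarrow> 0 \<le> nrm E x"
    and nrm_eq_0_iff: "x \<in> carr E \<Longrightarrow> nrm E x = 0 \<longleftrightarrow> x = 0"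
    and nrm_triangle: "x \<in> carr E \<Longrightarrow> y \<in> carr E \<Longrightarrow> nrm E (x + y) \<le> nrm E x + nrm E y"
    and nrm_scal: "x \<in> carr E \<Longrightarrow> nrm E (scal E a x) = norm a * nrm E x"

locale banach_space = normed_space +
  assumes complete: "Metric_space.mcomplete (carr E) (ndist E)"

definition scalars :: "('k::real_normed_field, 'k) nspace" where
  "scalars = \<lparr>carr = UNIV, scal = (*), nrm = norm\<rparr>"

text \<open>\<open>restr E A\<close> is the subspace \<open>A\<close> of \<open>E\<close> with the inherited norm.\<close>

definition restr :: "('k, 'v) nspace \<Rightarrow> 'v set \<Rightarrow> ('k, 'v) nspace" where
  "restr E A = E\<lparr>carr := A\<rparr>"


section \<open>Operators\<close>

definition linear_map ::
  "('k, 'v::ab_group_add) nspace \<Rightarrow> ('k, 'w::ab_group_add) nspace \<Rightarrow> ('v \<Rightarrow> 'w) \<Rightarrow> bool" where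
  "linear_map E F T \<longleftrightarrow>
     T \<in> carr E \<rightarrow> carr F \<and>
     (\<forall>x\<in>carr E. \<forall>y\<in>carr E. T (x + y) = T x + T y) \<and>
     (\<forall>a. \<forall>x\<in>carr E. T (scal E a x) = scal F a (T x))"

text \<open>Operators are normalised to be \<open>0\<close> off the carrier, so that equality of operators is equality
  of functions and sums, scalar multiples and products of operators are the pointwise operations
  and \<open>(\<circ>)\<close>.\<close>

definition bounded_ops ::
  "('k, 'v::ab_group_add) nspace \<Rightarrow> ('k, 'w::ab_group_add) nspace \<Rightarrow> ('v \<Rightarrow> 'w) set" where
  "bounded_ops E F = {T. linear_map E F T \<and>
     (\<exists>C. \<forall>x\<in>carr E. nrm F (T x) \<le> C * nrm E x) \<and> (\<forall>x. x \<notin> carr E \<longrightarrow> T x = 0)}"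

definition op_space ::
  "('k, 'v::ab_group_add) nspace \<Rightarrow> ('k, 'w::ab_group_add) nspace \<Rightarrow> ('k, 'v \<Rightarrow> 'w) nspace" where
  "op_space E F =
     \<lparr>carr = bounded_ops E F,
      scal = (\<lambda>a T x. scal F a (T x)),
      nrm = (\<lambda>T. SUP x \<in> {x \<in> carr E. nrm E x \<le> 1}. nrm F (T x))\<rparr>"

definition dual :: "('k::real_normed_field, 'v::ab_group_add) nspace \<Rightarrow> ('k, 'v \<Rightarrow> 'k) nspace" where
  "dual E = op_space E scalars"

definition finite_rank_ops ::
  "('k, 'v::ab_group_add) nspace \<Rightarrow> ('k, 'w::ab_group_add) nspace \<Rightarrow> ('v \<Rightarrow> 'w) set" where
  "finite_rank_ops E F = {T \<in> bounded_ops E F.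
     \<exists>B. finite B \<and> B \<subseteq> carr F \<and> (\<forall>x\<in>carr E. \<exists>a. T x = (\<Sum>b\<in>B. scal F (a b) b))}"

definition approximable_ops ::
  "('k, 'v::ab_group_add) nspace \<Rightarrow> ('k, 'w::ab_group_add) nspace \<Rightarrow> ('v \<Rightarrow> 'w) set" where
  "approximable_ops E F = ntop (op_space E F) closure_of finite_rank_ops E F"

definition compact_ops ::
  "('k, 'v::ab_group_add) nspace \<Rightarrow> ('k, 'w::ab_group_add) nspace \<Rightarrow> ('v \<Rightarrow> 'w) set" where
  "compact_ops E F = {T \<in> bounded_ops E F.
     compactin (ntop F) (ntop F closure_of (T ` {x \<in> carr E. nrm E x \<le> 1}))}"

definition approximation_property :: "('k, 'v::ab_group_add) nspace \<Rightarrow> bool" where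
  "approximation_property E \<longleftrightarrow>
     (\<forall>K e. compactin (ntop E) K \<and> 0 < e \<longrightarrow>
        (\<exists>T\<in>finite_rank_ops E E. \<forall>x\<in>K. nrm E (T x - x) < e))"

definition linear_homeomorphism ::
  "('k, 'v::ab_group_add) nspace \<Rightarrow> ('k, 'w::ab_group_add) nspace \<Rightarrow> ('v \<Rightarrow> 'w) \<Rightarrow> bool" where
  "linear_homeomorphism E F f \<longleftrightarrow> linear_map E F f \<and> homeomorphic_map (ntop E) (ntop F) f"

definition linearly_isomorphic ::
  "('k, 'v::ab_group_add) nspace \<Rightarrow> ('k, 'w::ab_group_add) nspace \<Rightarrow> bool" where
  "linearly_isomorphic E F \<longleftrightarrow> (\<exists>f. linear_homeomorphism E F f)"

text \<open>Isomorphism of two subalgebras \<open>\<A>\<close>, \<open>\<B>\<close> of the algebra of bounded operators on \<open>E\<close>.\<close>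

definition algebra_isomorphic ::
  "('k, 'v::ab_group_add) nspace \<Rightarrow> ('v \<Rightarrow> 'v) set \<Rightarrow> ('v \<Rightarrow> 'v) set \<Rightarrow> bool" where
  "algebra_isomorphic E \<A> \<B> \<longleftrightarrow>
     (\<exists>\<phi>. linear_homeomorphism (restr (op_space E E) \<A>) (restr (op_space E E) \<B>) \<phi> \<and>
          (\<forall>S\<in>\<A>. \<forall>T\<in>\<A>. \<phi> (S \<circ> T) = \<phi> S \<circ> \<phi> T))"


section \<open>Direct sums and operator matrices\<close>

definition lp_sum ::
  "real \<Rightarrow> 'i set \<Rightarrow> ('i \<Rightarrow> ('k, 'v::ab_group_add) nspace) \<Rightarrow> ('k, 'i \<Rightarrow> 'v) nspace" where
  "lp_sum p I E =
     \<lparr>carr = {z. (\<forall>i\<in>I. z i \<in> carr (E i)) \<and> (\<forall>i. i \<notin> I \<longrightarrow> z i = 0) \<and>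
                 (\<lambda>i. nrm (E i) (z i) powr p) summable_on I},
      scal = (\<lambda>a z i. scal (E i) a (z i)),
      nrm = (\<lambda>z. (\<Sum>\<^sub>\<infinity>i\<in>I. nrm (E i) (z i) powr p) powr (1 / p))\<rparr>"

text \<open>\<open>X\<close> and \<open>Y\<close> share one ambient type \<open>'v\<close>, but not necessarily the scalar multiplication, the
  carrier or the norm.  This is no restriction: spaces over types \<open>'x\<close> and \<open>'y\<close> can be placed in
  \<open>'x \<times> 'y\<close>.\<close>

definition Z_comp ::
  "('k, 'v::ab_group_add) nspace \<Rightarrow> ('k, 'v) nspace \<Rightarrow> nat \<Rightarrow> ('k, 'v) nspace" where
  "Z_comp X Y j = (if j = 0 then Y else X)"

definition Z_space ::
  "real \<Rightarrow> ('k, 'v::ab_group_add) nspace \<Rightarrow> ('k, 'v) nspace \<Rightarrow> ('k, nat \<Rightarrow> 'v) nspace" where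
  "Z_space p X Y = lp_sum p UNIV (Z_comp X Y)"

definition Z_proj ::
  "real \<Rightarrow> ('k, 'v::ab_group_add) nspace \<Rightarrow> ('k, 'v) nspace \<Rightarrow> nat \<Rightarrow> (nat \<Rightarrow> 'v) \<Rightarrow> 'v" where
  "Z_proj p X Y j z = (if z \<in> carr (Z_space p X Y) then z j else 0)"

definition Z_incl ::
  "('k, 'v::ab_group_add) nspace \<Rightarrow> ('k, 'v) nspace \<Rightarrow> nat \<Rightarrow> 'v \<Rightarrow> (nat \<Rightarrow> 'v)" where
  "Z_incl X Y k x = (\<lambda>j. if j = k \<and> x \<in> carr (Z_comp X Y k) then x else 0)"

definition entry ::
  "real \<Rightarrow> ('k, 'v::ab_group_add) nspace \<Rightarrow> ('k, 'v) nspace \<Rightarrow>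
   ((nat \<Rightarrow> 'v) \<Rightarrow> (nat \<Rightarrow> 'v)) \<Rightarrow> nat \<Rightarrow> nat \<Rightarrow> 'v \<Rightarrow> 'v" where
  "entry p X Y S j k = Z_proj p X Y j \<circ> S \<circ> Z_incl X Y k"


section \<open>The algebras\<close>

definition I_set ::
  "real \<Rightarrow> ('k, 'v::ab_group_add) nspace \<Rightarrow> ('k, 'v) nspace \<Rightarrow> nat set \<Rightarrow>
   ((nat \<Rightarrow> 'v) \<Rightarrow> (nat \<Rightarrow> 'v)) set" where
  "I_set p X Y B = {S \<in> compact_ops (Z_space p X Y) (Z_space p X Y).
     entry p X Y S 0 0 \<in> approximable_ops Y Y \<and>
     (\<forall>k\<in>B. entry p X Y S 0 k \<in> approximable_ops X Y)}"

definition F_family ::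
  "real \<Rightarrow> ('k, 'v::ab_group_add) nspace \<Rightarrow> ('k, 'v) nspace \<Rightarrow>
   ((nat \<Rightarrow> 'v) \<Rightarrow> (nat \<Rightarrow> 'v)) set set" where
  "F_family p X Y = {I_set p X Y B | B. B \<noteq> {} \<and> B \<subset> {1..}}"

text \<open>Scalar sequences are indexed by \<open>{1..}\<close>; the value at \<open>0\<close> is never used.\<close>

definition ell1 :: "(nat \<Rightarrow> 'k::real_normed_field) set" where
  "ell1 = {c. c abs_summable_on {1..}}"

definition supp :: "(nat \<Rightarrow> 'k::zero) \<Rightarrow> nat set" where
  "supp c = {j \<in> {1..}. c j \<noteq> 0}"

text \<open>In \<open>I_seq\<close>, \<open>T\<close> is the operator taking \<open>x\<close> to the sum of the series in the norm of \<open>Y\<close>.\<close>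

definition I_seq ::
  "real \<Rightarrow> ('k, 'v::ab_group_add) nspace \<Rightarrow> ('k, 'v) nspace \<Rightarrow> (nat \<Rightarrow> 'k) \<Rightarrow>
   ((nat \<Rightarrow> 'v) \<Rightarrow> (nat \<Rightarrow> 'v)) set" where
  "I_seq p X Y c = {S \<in> compact_ops (Z_space p X Y) (Z_space p X Y).
     entry p X Y S 0 0 \<in> approximable_ops Y Y \<and>
     (\<exists>T\<in>approximable_ops X Y. \<forall>x\<in>carr X.
        limitin (ntop Y) (\<lambda>n. \<Sum>r=1..n. scal Y (c r) (entry p X Y S 0 r x)) (T x) sequentially)}"

text \<open>The support may be infinite, where \<open>card\<close> is \<open>0\<close>.\<close>

definition F_plus_family ::
  "real \<Rightarrow> ('k::real_normed_field, 'v::ab_group_add) nspace \<Rightarrow> ('k, 'v) nspace \<Rightarrow>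
   ((nat \<Rightarrow> 'v) \<Rightarrow> (nat \<Rightarrow> 'v)) set set" where
  "F_plus_family p X Y =
     {I_seq p X Y c | c. c \<in> ell1 \<and> (infinite (supp c) \<or> 2 \<le> card (supp c))}"

end

theory Submission
  imports Defs
begin

text \<open>
  Every isomorphism in the theorem is a conjugation \<open>S \<mapsto> V \<circ> S \<circ> U\<close> by an invertible operator \<open>U\<close> of
  \<open>Z\<^sub>p\<close> with inverse \<open>V\<close>.  Conjugation is always a linear homeomorphism that respects products and
  keeps compactness, so only the conditions on the zeroth row \<open>P\<^sub>0 \<circ> S\<close> have to be followed.  All
  operators \<open>U\<close> used here fix the summand \<open>Y\<close> and keep the \<open>Y\<close>-coordinate of every vector; then the
  corner \<open>S\<^sub>0\<^sub>0\<close> does not change, and the column \<open>P\<^sub>0 \<circ> S \<circ> W\<close> over \<open>W\<close> turns into \<open>P\<^sub>0 \<circ> S \<circ> (U \<circ> W)\<close>.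

  For \<open>c \<in> \<ell>\<^sup>1\<close> let \<open>\<psi>\<^sub>c x = (0, c\<^sub>1 x, c\<^sub>2 x, \<dots>)\<close>, a bounded operator from \<open>X\<close> to \<open>Z\<^sub>p\<close>.  The series in the
  definition of \<open>\<I>(c)\<close> sums to \<open>P\<^sub>0 \<circ> S \<circ> \<psi>\<^sub>c\<close>.  If \<open>c\<^sub>j \<noteq> 0\<close>, the shear
  \<open>z \<mapsto> z + \<psi>\<^sub>b (z\<^sub>j)\<close> with \<open>b = c - e\<^sub>j\<close> is invertible and carries the inclusion of the \<open>j\<close>-th summand to
  \<open>\<psi>\<^sub>c\<close>; hence \<open>\<I>(c) \<cong> \<I>\<^bsub>{j}\<^esub>\<close> (lemma \<open>conjugate_I_seq_I_set\<close>).  Taking \<open>c = e\<^sub>j + e\<^sub>k\<close>, which has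
  both \<open>j\<close> and \<open>k\<close> in its support, gives \<open>\<I>\<^bsub>{j}\<^esub> \<cong> \<I>\<^bsub>{k}\<^esub>\<close>, and the first two claims follow by composing.

  For the last claim let \<open>f\<close> be an isomorphism of the \<open>\<ell>\<^sup>p\<close>-sum of copies of \<open>X\<close> onto \<open>X\<close>.  It
  splits each summand \<open>X\<close> of \<open>Z\<^sub>p\<close> into countably many copies of \<open>X\<close>, indexed by \<open>\<nat> \<times> \<nat>\<close> in total.
  A bijection of \<open>\<nat> \<times> \<nat>\<close> that takes \<open>B \<times> \<nat>\<close> onto \<open>C \<times> \<nat>\<close> permutes these copies and induces an
  operator \<open>U\<close> that carries the sum of the summands over \<open>C\<close> onto the sum of those over \<open>B\<close>.  So
  conjugating \<open>S \<in> \<I>\<^sub>B\<close> by \<open>U\<close> gives an element of \<open>\<I>\<^sub>C\<close> as soon as the following holds: if \<open>R\<close>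
  is compact on \<open>Z\<^sub>p\<close> with all columns over \<open>B\<close> approximable, then \<open>R \<circ> W\<close> is approximable for every
  bounded \<open>W\<close> whose values are supported in \<open>B\<close> (lemma \<open>column_operator_approximable\<close>).  For finite
  \<open>B\<close> this is clear.  For infinite \<open>B\<close> it rests on the fact that a compact operator on an \<open>\<ell>\<^sup>p\<close>-sum with
  \<open>p > 1\<close> has small norm on the vectors that vanish on a long initial segment (lemma
  \<open>compact_op_small_on_tails\<close>), which a gliding hump argument shows.
\<close>


section \<open>Normed spaces and linear maps\<close>

lemma carr_restr [simp]: "carr (restr E A) = A"
  and scal_restr [simp]: "scal (restr E A) = scal E"
  and nrm_restr [simp]: "nrm (restr E A) = nrm E"
  and restr_carr [simp]: "restr E (carr E) = E"
  by (simp_all add: restr_def)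

context normed_space
begin

lemma zero_in [simp, intro]: "0 \<in> carr E"
  and add_in [intro]: "x \<in> carr E \<Longrightarrow> y \<in> carr E \<Longrightarrow> x + y \<in> carr E"
  and scal_in [intro]: "x \<in> carr E \<Longrightarrow> scal E a x \<in> carr E"
  using carr_subspace unfolding subspace_def by auto

lemma diff_in [intro]: "x \<in> carr E \<Longrightarrow> y \<in> carr E \<Longrightarrow> x - y \<in> carr E"
  using carr_subspace by (rule subspace_diff)

lemma sum_in: "(\<And>i. i \<in> I \<Longrightarrow> x i \<in> carr E) \<Longrightarrow> sum x I \<in> carr E"
  using carr_subspace by (rule subspace_sum)

lemma nrm_zero [simp]: "nrm E 0 = 0"
  using nrm_eq_0_iff by blast

lemma nrm_uminus: "x \<in> carr E \<Longrightarrow> nrm E (- x) = nrm E x"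
  using nrm_scal[of x "- 1"] by simp

lemma nrm_diff_commute: "x \<in> carr E \<Longrightarrow> y \<in> carr E \<Longrightarrow> nrm E (x - y) = nrm E (y - x)"
  using nrm_uminus[of "x - y"] by (simp add: diff_in)

lemma nrm_diff_triangle:
  assumes "x \<in> carr E" "y \<in> carr E" "z \<in> carr E"
  shows "nrm E (x - z) \<le> nrm E (x - y) + nrm E (y - z)"
  using nrm_triangle[of "x - y" "y - z"] assms by (simp add: diff_in)

lemma nrm_diff_le:
  assumes "x \<in> carr E" "y \<in> carr E"
  shows "nrm E (x - y) \<le> nrm E x + nrm E y"
  using nrm_diff_triangle[of x 0 y] assms by (simp add: nrm_uminus)

lemma nrm_sum:
  "finite I \<Longrightarrow> (\<And>i. i \<in> I \<Longrightarrow> x i \<in> carr E) \<Longrightarrow> nrm E (sum x I) \<le> (\<Sum>i\<in>I. nrm E (x i))"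
proof (induction I rule: finite_induct)
  case (insert a I)
  then show ?case
    using nrm_triangle[of "x a" "sum x I"] by (simp add: sum_in)
qed auto

lemma Metric_space_restr:
  assumes "A \<subseteq> carr E"
  shows "Metric_space A (ndist (restr E A))"
proof
  have A: "x \<in> carr E" if "x \<in> A" for x using assms that by auto
  show "0 \<le> ndist (restr E A) x y" for x y
    by (auto simp: ndist_def A intro!: nrm_nonneg)
  show "ndist (restr E A) x y = ndist (restr E A) y x" for x y
    by (auto simp: ndist_def A nrm_diff_commute)
  show "(ndist (restr E A) x y = 0) = (x = y)" if "x \<in> A" "y \<in> A" for x y
    using that nrm_eq_0_iff[OF diff_in[OF A A]] by (simp add: ndist_def)
  show "ndist (restr E A) x z \<le> ndist (restr E A) x y + ndist (restr E A) y z"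
    if "x \<in> A" "y \<in> A" "z \<in> A" for x y z
    using that nrm_diff_triangle by (auto simp: ndist_def A)
qed

lemma Metric_space_ndist: "Metric_space (carr E) (ndist E)"
  using Metric_space_restr[of "carr E"] by simp

lemma topspace_ntop [simp]: "topspace (ntop E) = carr E"
  unfolding ntop_def using Metric_space.topspace_mtopology[OF Metric_space_ndist] .

lemma limitin_ntop:
  "limitin (ntop E) u l sequentially \<longleftrightarrow>
     l \<in> carr E \<and> (\<forall>e>0. \<forall>\<^sub>F n in sequentially. u n \<in> carr E \<and> nrm E (u n - l) < e)"
proof -
  have *: "(a \<in> carr E \<and> ndist E a l < e) = (a \<in> carr E \<and> nrm E (a - l) < e)"
    if "l \<in> carr E" for e a using that by (auto simp: ndist_def)
  show ?thesis
    unfolding ntop_def Metric_space.limitin_metric[OF Metric_space_ndist]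
    by (auto simp: *)
qed

lemma limitin_ntop_unique:
  "limitin (ntop E) u l sequentially \<Longrightarrow> limitin (ntop E) u m sequentially \<Longrightarrow> l = m"
  unfolding ntop_def
  using Metric_space.limitin_metric_unique[OF Metric_space_ndist] trivial_limit_sequentially
  by blast

end

text \<open>Subspaces enter here because an isomorphism of two algebras of operators is a map between
  subsets of the operator space with the inherited norm.\<close>

lemma continuous_map_ntop_iff:
  assumes "normed_space E" "normed_space F" "A \<subseteq> carr E" "B \<subseteq> carr F"
  shows "continuous_map (ntop (restr E A)) (ntop (restr F B)) f \<longleftrightarrow>
    f ` A \<subseteq> B \<and>
    (\<forall>a\<in>A. \<forall>e>0. \<exists>d>0. \<forall>x\<in>A. nrm E (a - x) < d \<longrightarrow> nrm F (f a - f x) < e)"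
proof -
  have "continuous_map (ntop (restr E A)) (ntop (restr F B)) f \<longleftrightarrow>
    f ` A \<subseteq> B \<and> (\<forall>a\<in>A. \<forall>e>0. \<exists>d>0. \<forall>x. x \<in> A \<and> ndist (restr E A) a x < d \<longrightarrow>
      ndist (restr F B) (f a) (f x) < e)"
    unfolding ntop_def carr_restr
    using Metric_space.metric_continuous_map[OF normed_space.Metric_space_restr[OF assms(1,3)]
        normed_space.Metric_space_restr[OF assms(2,4)]] .
  also have "\<dots> \<longleftrightarrow> f ` A \<subseteq> B \<and>
    (\<forall>a\<in>A. \<forall>e>0. \<exists>d>0. \<forall>x\<in>A. nrm E (a - x) < d \<longrightarrow> nrm F (f a - f x) < e)"
    by (intro conj_cong refl ball_cong all_cong imp_cong ex_cong) (auto simp: ndist_def image_subset_iff)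
  finally show ?thesis .
qed

lemma continuous_map_Lipschitz:
  assumes "normed_space E" "normed_space F" "A \<subseteq> carr E" "B \<subseteq> carr F"
    and f: "f \<in> A \<rightarrow> B"
    and C: "\<And>x y. x \<in> A \<Longrightarrow> y \<in> A \<Longrightarrow> nrm F (f x - f y) \<le> C * nrm E (x - y)"
  shows "continuous_map (ntop (restr E A)) (ntop (restr F B)) f"
  unfolding continuous_map_ntop_iff[OF assms(1-4)]
proof (intro conjI ballI allI impI)
  interpret E: normed_space E by fact
  show "f ` A \<subseteq> B" using f by auto
  fix a e :: _ assume a: "a \<in> A" and e: "(0::real) < e"
  define K where "K = \<bar>C\<bar> + 1"
  have K: "K > 0" "C \<le> K" by (auto simp: K_def)
  show "\<exists>d>0. \<forall>x\<in>A. nrm E (a - x) < d \<longrightarrow> nrm F (f a - f x) < e"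
  proof (intro exI conjI ballI impI)
    show "e / K > 0" using e K by simp
    fix x assume x: "x \<in> A" and less: "nrm E (a - x) < e / K"
    have "nrm F (f a - f x) \<le> C * nrm E (a - x)" using C a x by auto
    also have "\<dots> \<le> K * nrm E (a - x)"
      using a x assms(3) K by (intro mult_right_mono E.nrm_nonneg E.diff_in) auto
    also have "\<dots> < e" using less K by (simp add: field_simps)
    finally show "nrm F (f a - f x) < e" .
  qed
qed


lemma linear_map_zero:
  assumes "normed_space E" "linear_map E F T"
  shows "T 0 = 0"
proof -
  interpret E: normed_space E by fact
  have "T (0 + 0) = T 0 + T 0" using assms(2) E.zero_in unfolding linear_map_def by blast
  then show ?thesis by simp
qed

lemma linear_map_in: "linear_map E F T \<Longrightarrow> x \<in> carr E \<Longrightarrow> T x \<in> carr F"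
  and linear_map_add: "linear_map E F T \<Longrightarrow> x \<in> carr E \<Longrightarrow> y \<in> carr E \<Longrightarrow> T (x + y) = T x + T y"
  and linear_map_scal: "linear_map E F T \<Longrightarrow> x \<in> carr E \<Longrightarrow> T (scal E a x) = scal F a (T x)"
  unfolding linear_map_def by auto

lemma linear_map_diff:
  assumes "normed_space E" "linear_map E F T" "x \<in> carr E" "y \<in> carr E"
  shows "T (x - y) = T x - T y"
proof -
  interpret E: normed_space E by fact
  have "T ((x - y) + y) = T (x - y) + T y" using assms linear_map_add[OF assms(2)] by blast
  then show ?thesis by simp
qed

lemma linear_map_sum:
  assumes "normed_space E" "linear_map E F T" "\<And>i. i \<in> I \<Longrightarrow> x i \<in> carr E"
  shows "T (sum x I) = (\<Sum>i\<in>I. T (x i))"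
  using assms(3)
proof (induction I rule: infinite_finite_induct)
  case (insert a I)
  then show ?case
    using linear_map_add[OF assms(2), of "x a" "sum x I"] normed_space.sum_in[OF assms(1), of I x]
    by simp
qed (auto simp: linear_map_zero[OF assms(1,2)])

lemma linear_map_continuous_bounded:
  assumes E: "normed_space E" and F: "normed_space F" and T: "linear_map E F T"
    and cont: "continuous_map (ntop E) (ntop F) T"
  shows "\<exists>C. \<forall>x\<in>carr E. nrm F (T x) \<le> C * nrm E x"
proof -
  interpret E: normed_space E by fact
  interpret F: normed_space F by fact
  have "continuous_map (ntop (restr E (carr E))) (ntop (restr F (carr F))) T"
    using cont by simp
  then have "\<forall>e>0. \<exists>d>0. \<forall>x\<in>carr E. nrm E (0 - x) < d \<longrightarrow> nrm F (T 0 - T x) < e"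
    using continuous_map_ntop_iff[OF E F order_refl order_refl] E.zero_in by blast
  then obtain d where d: "d > 0"
    and *: "\<And>x. x \<in> carr E \<Longrightarrow> nrm E (0 - x) < d \<Longrightarrow> nrm F (T 0 - T x) < 1"
    using zero_less_one by blast
  have "nrm F (T x) \<le> 2 / d * nrm E x" if x: "x \<in> carr E" for x
  proof (cases "x = 0")
    case True
    then show ?thesis by (simp add: linear_map_zero[OF E T])
  next
    case False
    then have n: "nrm E x > 0" using E.nrm_nonneg[OF x] E.nrm_eq_0_iff[OF x] by simp
    define t where "t = d / (2 * nrm E x)"
    have t: "t > 0" using d n by (simp add: t_def)
    let ?y = "scal E (of_real t) x"
    have y: "?y \<in> carr E" using x by auto
    have "nrm E ?y = d / 2" using E.nrm_scal[OF x, of "of_real t"] t n d unfolding norm_of_real by (simp add: t_def)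
    then have "nrm F (T 0 - T ?y) < 1" using * y d by (simp add: E.nrm_uminus)
    then have "nrm F (T ?y) < 1"
      using linear_map_in[OF T y] by (simp add: linear_map_zero[OF E T] F.nrm_uminus)
    moreover have "nrm F (T ?y) = t * nrm F (T x)"
      using F.nrm_scal[OF linear_map_in[OF T x], of "of_real t"] linear_map_scal[OF T x] t by simp
    ultimately have "t * nrm F (T x) < 1" by simp
    then show ?thesis using n d by (simp add: t_def field_simps)
  qed
  then show ?thesis by blast
qed


section \<open>Bounded operators and the operator norm\<close>

lemma bounded_ops_linear: "T \<in> bounded_ops E F \<Longrightarrow> linear_map E F T"
  by (simp add: bounded_ops_def)

lemma bounded_ops_in: "T \<in> bounded_ops E F \<Longrightarrow> x \<in> carr E \<Longrightarrow> T x \<in> carr F"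
  unfolding bounded_ops_def using linear_map_in by blast

lemma bounded_ops_off: "T \<in> bounded_ops E F \<Longrightarrow> x \<notin> carr E \<Longrightarrow> T x = 0"
  by (simp add: bounded_ops_def)

lemma bounded_ops_in': "normed_space F \<Longrightarrow> T \<in> bounded_ops E F \<Longrightarrow> T x \<in> carr F"
  by (metis bounded_ops_in bounded_ops_off normed_space.zero_in)

lemma bounded_opsI:
  "linear_map E F T \<Longrightarrow> (\<And>x. x \<in> carr E \<Longrightarrow> nrm F (T x) \<le> C * nrm E x) \<Longrightarrow>
    (\<And>x. x \<notin> carr E \<Longrightarrow> T x = 0) \<Longrightarrow> T \<in> bounded_ops E F"
  unfolding bounded_ops_def by blast

lemma bounded_ops_bound:
  assumes "normed_space E" "T \<in> bounded_ops E F"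
  shows "\<exists>C>0. \<forall>x\<in>carr E. nrm F (T x) \<le> C * nrm E x"
proof -
  interpret E: normed_space E by fact
  obtain C where C: "\<And>x. x \<in> carr E \<Longrightarrow> nrm F (T x) \<le> C * nrm E x"
    using assms(2) unfolding bounded_ops_def by blast
  have "nrm F (T x) \<le> (\<bar>C\<bar> + 1) * nrm E x" if x: "x \<in> carr E" for x
    using C[OF x] mult_right_mono[of C "\<bar>C\<bar> + 1" "nrm E x"] E.nrm_nonneg[OF x] by linarith
  then show ?thesis by (intro exI[of _ "\<bar>C\<bar> + 1"]) auto
qed

lemma bounded_ops_comp:
  assumes E: "normed_space E" and F: "normed_space F"
    and T: "T \<in> bounded_ops E F" and S: "S \<in> bounded_ops F G"
  shows "S \<circ> T \<in> bounded_ops E G"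
proof -
  obtain C where C: "C > 0" "\<And>x. x \<in> carr E \<Longrightarrow> nrm F (T x) \<le> C * nrm E x"
    using bounded_ops_bound[OF E T] by blast
  obtain D where D: "D > 0" "\<And>x. x \<in> carr F \<Longrightarrow> nrm G (S x) \<le> D * nrm F x"
    using bounded_ops_bound[OF F S] by blast
  show ?thesis
  proof (rule bounded_opsI)
    show "linear_map E G (S \<circ> T)"
      using bounded_ops_linear[OF T] bounded_ops_linear[OF S]
      by (auto simp: linear_map_def Pi_iff)
    show "nrm G ((S \<circ> T) x) \<le> D * C * nrm E x" if "x \<in> carr E" for x
      using D(2)[OF bounded_ops_in[OF T that]] C(2)[OF that] D(1)
      by (smt (verit, ccfv_SIG) comp_apply mult.assoc mult_left_mono)
    show "(S \<circ> T) x = 0" if "x \<notin> carr E" for x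
      using that by (simp add: bounded_ops_off[OF T] linear_map_zero[OF F bounded_ops_linear[OF S]])
  qed
qed

lemma bounded_ops_eqI:
  assumes "S \<in> bounded_ops E F" "T \<in> bounded_ops E F" "\<And>x. x \<in> carr E \<Longrightarrow> S x = T x"
  shows "S = T"
  using assms bounded_ops_off by (metis ext)

lemma bounded_ops_zero:
  assumes E: "normed_space E" and F: "normed_space F"
  shows "0 \<in> bounded_ops E F"
proof -
  interpret F: normed_space F by fact
  show ?thesis
    by (rule bounded_opsI[of _ _ _ 0]) (auto simp: linear_map_def zero_fun_def)
qed

lemma bounded_ops_add:
  assumes E: "normed_space E" and F: "normed_space F"
    and T: "T \<in> bounded_ops E F" and S: "S \<in> bounded_ops E F"
  shows "S + T \<in> bounded_ops E F"
proof -
  interpret E: normed_space E by fact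
  interpret F: normed_space F by fact
  obtain C where C: "C > 0" "\<And>x. x \<in> carr E \<Longrightarrow> nrm F (T x) \<le> C * nrm E x"
    using bounded_ops_bound[OF E T] by blast
  obtain D where D: "D > 0" "\<And>x. x \<in> carr E \<Longrightarrow> nrm F (S x) \<le> D * nrm E x"
    using bounded_ops_bound[OF E S] by blast
  show ?thesis
  proof (rule bounded_opsI)
    show "linear_map E F (S + T)"
      using bounded_ops_linear[OF T] bounded_ops_linear[OF S]
      by (auto simp: linear_map_def Pi_iff F.scale_right_distrib algebra_simps)
    show "nrm F ((S + T) x) \<le> (D + C) * nrm E x" if "x \<in> carr E" for x
      using D(2)[OF that] C(2)[OF that] F.nrm_triangle[OF bounded_ops_in[OF S that] bounded_ops_in[OF T that]]
      by (simp add: algebra_simps)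
    show "(S + T) x = 0" if "x \<notin> carr E" for x
      using that by (simp add: bounded_ops_off[OF T] bounded_ops_off[OF S])
  qed
qed

lemma bounded_ops_scal:
  assumes E: "normed_space E" and F: "normed_space F"
    and T: "T \<in> bounded_ops E F"
  shows "(\<lambda>x. scal F a (T x)) \<in> bounded_ops E F"
proof -
  interpret F: normed_space F by fact
  obtain C where C: "C > 0" "\<And>x. x \<in> carr E \<Longrightarrow> nrm F (T x) \<le> C * nrm E x"
    using bounded_ops_bound[OF E T] by blast
  show ?thesis
  proof (rule bounded_opsI)
    show "linear_map E F (\<lambda>x. scal F a (T x))"
      using bounded_ops_linear[OF T]
      by (auto simp: linear_map_def Pi_iff F.scale_right_distrib mult.commute)
    show "nrm F (scal F a (T x)) \<le> (norm a * C) * nrm E x" if "x \<in> carr E" for x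
      using C(2)[OF that] F.nrm_scal[OF bounded_ops_in[OF T that], of a]
      by (simp add: mult.assoc mult_left_mono)
    show "scal F a (T x) = 0" if "x \<notin> carr E" for x
      using that by (simp add: bounded_ops_off[OF T])
  qed
qed


lemma carr_op_space [simp]: "carr (op_space E F) = bounded_ops E F"
  and scal_op_space [simp]: "scal (op_space E F) a T = (\<lambda>x. scal F a (T x))"
  by (simp_all add: op_space_def)

lemma nrm_op_bound:
  fixes E :: "('k::real_normed_field, 'v::ab_group_add) nspace"
    and F :: "('k, 'w::ab_group_add) nspace"
  assumes E: "normed_space E" and F: "normed_space F" and T: "T \<in> bounded_ops E F"
    and x: "x \<in> carr E"
  shows "nrm F (T x) \<le> nrm (op_space E F) T * nrm E x"
proof -
  interpret E: normed_space E by fact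
  interpret F: normed_space F by fact
  have bdd: "bdd_above ((\<lambda>x. nrm F (T x)) ` {x \<in> carr E. nrm E x \<le> 1})"
  proof -
    obtain C where "C > 0" "\<And>x. x \<in> carr E \<Longrightarrow> nrm F (T x) \<le> C * nrm E x"
      using bounded_ops_bound[OF E T] by blast
    then show ?thesis
      by (intro bdd_aboveI2[of _ _ C]) (smt (verit) mem_Collect_eq mult_left_le)
  qed
  show ?thesis
  proof (cases "x = 0")
    case True
    then show ?thesis by (simp add: linear_map_zero[OF E bounded_ops_linear[OF T]])
  next
    case False
    then have n: "nrm E x > 0" using E.nrm_nonneg[OF x] E.nrm_eq_0_iff[OF x] by simp
    define a :: 'k where "a = of_real (1 / nrm E x)"
    have a: "norm a = 1 / nrm E x" unfolding a_def norm_of_real using n by simp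
    have "nrm E (scal E a x) = 1" using E.nrm_scal[OF x, of a] n by (simp add: a)
    then have "nrm F (T (scal E a x)) \<le> nrm (op_space E F) T"
      unfolding op_space_def using bdd E.scal_in[OF x] by (auto intro!: cSUP_upper)
    moreover have "nrm F (T (scal E a x)) = nrm F (T x) / nrm E x"
      using F.nrm_scal[OF bounded_ops_in[OF T x], of a] n
        linear_map_scal[OF bounded_ops_linear[OF T] x] by (simp add: a)
    ultimately show ?thesis using n by (simp add: field_simps)
  qed
qed

lemma nrm_op_le:
  assumes E: "normed_space E" and C: "0 \<le> C"
    and "\<And>x. x \<in> carr E \<Longrightarrow> nrm F (T x) \<le> C * nrm E x"
  shows "nrm (op_space E F) T \<le> C"
proof -
  interpret E: normed_space E by fact
  show ?thesis
    unfolding op_space_def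
  proof (simp, rule cSUP_least)
    show "{x \<in> carr E. nrm E x \<le> 1} \<noteq> {}" by (auto intro!: exI[of _ 0])
    show "nrm F (T x) \<le> C" if "x \<in> {x \<in> carr E. nrm E x \<le> 1}" for x
      using assms(3)[of x] that C by (smt (verit) mem_Collect_eq mult_left_le)
  qed
qed

lemma nrm_op_nonneg:
  assumes E: "normed_space E" and F: "normed_space F" and T: "T \<in> bounded_ops E F"
  shows "0 \<le> nrm (op_space E F) T"
proof (rule ccontr)
  interpret E: normed_space E by fact
  interpret F: normed_space F by fact
  assume "\<not> ?thesis"
  then have neg: "nrm (op_space E F) T < 0" by simp
  have z: "T x = 0" for x
  proof (cases "x \<in> carr E")
    case True
    then have "nrm F (T x) \<le> 0"
      using nrm_op_bound[OF E F T True] neg E.nrm_nonneg[OF True]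
      by (smt (verit) mult_nonpos_nonneg)
    then show ?thesis
      using F.nrm_nonneg F.nrm_eq_0_iff bounded_ops_in[OF T True] by (meson order_antisym)
  qed (rule bounded_ops_off[OF T])
  have "nrm (op_space E F) T = (SUP x \<in> {x \<in> carr E. nrm E x \<le> 1}. 0)"
    by (simp add: op_space_def z)
  also have "\<dots> = 0" by (rule cSUP_const) (auto intro!: exI[of _ 0])
  finally show False using neg by simp
qed

lemma normed_space_op_space:
  assumes E: "normed_space E" and F: "normed_space F"
  shows "normed_space (op_space E F)"
proof -
  interpret E: normed_space E by fact
  interpret F: normed_space F by fact
  interpret O: vector_space "scal (op_space E F)"
    by unfold_locales (auto simp: fun_eq_iff F.scale_right_distrib F.scale_left_distrib)
  show ?thesis
  proof
    show "O.subspace (carr (op_space E F))"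
      unfolding O.subspace_def
      by (auto intro: bounded_ops_zero bounded_ops_add bounded_ops_scal E F)
    fix S assume S: "S \<in> carr (op_space E F)"
    then have S': "S \<in> bounded_ops E F" by simp
    show "0 \<le> nrm (op_space E F) S" using nrm_op_nonneg[OF E F S'] .
    show "nrm (op_space E F) S = 0 \<longleftrightarrow> S = 0"
    proof
      assume "nrm (op_space E F) S = 0"
      then have "nrm F (S x) \<le> 0" if "x \<in> carr E" for x
        using nrm_op_bound[OF E F S' that] by simp
      then show "S = 0"
        using bounded_ops_off[OF S'] F.nrm_nonneg F.nrm_eq_0_iff bounded_ops_in[OF S']
        by (metis ext order_antisym zero_fun_apply)
    next
      assume "S = 0"
      then show "nrm (op_space E F) S = 0"
        using nrm_op_nonneg[OF E F S'] nrm_op_le[OF E order_refl, of F S] by fastforce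
    qed
    show "nrm (op_space E F) (S + T) \<le> nrm (op_space E F) S + nrm (op_space E F) T"
      if T: "T \<in> carr (op_space E F)" for T
    proof (rule nrm_op_le[OF E])
      have T': "T \<in> bounded_ops E F" using T by simp
      show "0 \<le> nrm (op_space E F) S + nrm (op_space E F) T"
        using nrm_op_nonneg[OF E F] S' T' by simp
      show "nrm F ((S + T) x) \<le> (nrm (op_space E F) S + nrm (op_space E F) T) * nrm E x"
        if "x \<in> carr E" for x
        using nrm_op_bound[OF E F S' that] nrm_op_bound[OF E F T' that]
          F.nrm_triangle[OF bounded_ops_in[OF S' that] bounded_ops_in[OF T' that]]
        by (simp add: algebra_simps)
    qed
    have le: "nrm (op_space E F) (scal (op_space E F) a R) \<le> norm a * nrm (op_space E F) R"
      if R: "R \<in> bounded_ops E F" for a R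
    proof (rule nrm_op_le[OF E])
      show "0 \<le> norm a * nrm (op_space E F) R" using nrm_op_nonneg[OF E F R] by simp
      show "nrm F (scal (op_space E F) a R x) \<le> norm a * nrm (op_space E F) R * nrm E x"
        if "x \<in> carr E" for x
        using nrm_op_bound[OF E F R that] F.nrm_scal[OF bounded_ops_in[OF R that], of a]
        by (simp add: mult.assoc mult_left_mono)
    qed
    show "nrm (op_space E F) (scal (op_space E F) a S) = norm a * nrm (op_space E F) S" for a
    proof (cases "a = 0")
      case True
      then show ?thesis
        using le[OF S', of 0] nrm_op_nonneg[OF E F bounded_ops_scal[OF E F S', of 0]] by simp
    next
      case False
      let ?R = "scal (op_space E F) a S"
      have R: "?R \<in> bounded_ops E F" using bounded_ops_scal[OF E F S'] by simp
      have "S = scal (op_space E F) (inverse a) ?R" using False by (simp add: fun_eq_iff)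
      then have "nrm (op_space E F) S \<le> inverse (norm a) * nrm (op_space E F) ?R"
        using le[OF R, of "inverse a"] by (simp add: norm_inverse)
      then have "norm a * nrm (op_space E F) S \<le> nrm (op_space E F) ?R"
        using False by (simp add: field_simps)
      then show ?thesis using le[OF S', of a] by simp
    qed
  qed
qed


section \<open>Approximable and compact operators\<close>

text \<open>Stating approximation in the operator norm pointwise, with the bound \<open>e * nrm E x\<close>, avoids handling the
  supremum again.\<close>

lemma approximable_ops_iff:
  assumes E: "normed_space E" and F: "normed_space F"
  shows "T \<in> approximable_ops E F \<longleftrightarrow> T \<in> bounded_ops E F \<and>
    (\<forall>e>0. \<exists>R\<in>finite_rank_ops E F. \<forall>x\<in>carr E. nrm F (T x - R x) \<le> e * nrm E x)"
proof -
  let ?O = "op_space E F"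
  interpret O: normed_space ?O using normed_space_op_space[OF E F] .
  interpret M: Metric_space "bounded_ops E F" "ndist ?O"
    using O.Metric_space_ndist by simp
  have fr: "finite_rank_ops E F \<subseteq> bounded_ops E F" by (auto simp: finite_rank_ops_def)
  have "T \<in> approximable_ops E F \<longleftrightarrow> T \<in> bounded_ops E F \<and>
    (\<forall>r>0. \<exists>R\<in>finite_rank_ops E F. R \<in> M.mcball T r)"
    unfolding approximable_ops_def ntop_def using M.metric_closure_of_alt by simp
  also have "\<dots> \<longleftrightarrow> T \<in> bounded_ops E F \<and>
    (\<forall>e>0. \<exists>R\<in>finite_rank_ops E F. \<forall>x\<in>carr E. nrm F (T x - R x) \<le> e * nrm E x)"
  proof (intro conj_cong refl all_cong bex_cong)
    fix e R assume T: "T \<in> bounded_ops E F" and e: "(0::real) < e" and "R \<in> finite_rank_ops E F"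
    then have R: "R \<in> bounded_ops E F" and TR: "T - R \<in> bounded_ops E F"
      using fr O.diff_in[of T R] by auto
    have "R \<in> M.mcball T e \<longleftrightarrow> nrm ?O (T - R) \<le> e"
      using T R by (auto simp: ndist_def)
    also have "\<dots> \<longleftrightarrow> (\<forall>x\<in>carr E. nrm F (T x - R x) \<le> e * nrm E x)"
    proof
      assume le: "nrm ?O (T - R) \<le> e"
      show "\<forall>x\<in>carr E. nrm F (T x - R x) \<le> e * nrm E x"
      proof
        fix x assume x: "x \<in> carr E"
        have "nrm F ((T - R) x) \<le> nrm ?O (T - R) * nrm E x" by (rule nrm_op_bound[OF E F TR x])
        also have "\<dots> \<le> e * nrm E x" 
          using le normed_space.nrm_nonneg[OF E x] by (rule mult_right_mono)
        finally show "nrm F (T x - R x) \<le> e * nrm E x" by simp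
      qed
    next
      assume "\<forall>x\<in>carr E. nrm F (T x - R x) \<le> e * nrm E x"
      then show "nrm ?O (T - R) \<le> e" using e by (intro nrm_op_le[OF E]) auto
    qed
    finally show "R \<in> M.mcball T e \<longleftrightarrow> (\<forall>x\<in>carr E. nrm F (T x - R x) \<le> e * nrm E x)" .
  qed
  finally show ?thesis .
qed

lemma approximable_ops_bounded:
  assumes "normed_space E" "normed_space F" "T \<in> approximable_ops E F"
  shows "T \<in> bounded_ops E F"
  using assms approximable_ops_iff by blast

lemma approximable_ops_limit:
  assumes E: "normed_space E" and F: "normed_space F" and T: "T \<in> bounded_ops E F"
    and lim: "\<And>e. 0 < e \<Longrightarrow> \<exists>R\<in>approximable_ops E F. \<forall>x\<in>carr E. nrm F (T x - R x) \<le> e * nrm E x"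
  shows "T \<in> approximable_ops E F"
  unfolding approximable_ops_iff[OF E F]
proof (intro conjI allI impI)
  fix e :: real assume "0 < e"
  then obtain R where R: "R \<in> approximable_ops E F"
    and TR: "\<And>x. x \<in> carr E \<Longrightarrow> nrm F (T x - R x) \<le> e/2 * nrm E x"
    using lim[of "e/2"] by auto
  then obtain Q where Q: "Q \<in> finite_rank_ops E F"
    and RQ: "\<And>x. x \<in> carr E \<Longrightarrow> nrm F (R x - Q x) \<le> e/2 * nrm E x"
    using half_gt_zero[OF \<open>0 < e\<close>] unfolding approximable_ops_iff[OF E F] by blast
  have bR: "R \<in> bounded_ops E F" and bQ: "Q \<in> bounded_ops E F"
    using R Q approximable_ops_bounded[OF E F] by (auto simp: finite_rank_ops_def)
  have "nrm F (T x - Q x) \<le> e * nrm E x" if x: "x \<in> carr E" for x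
    using normed_space.nrm_diff_triangle[OF F, of "T x" "R x" "Q x"] TR[OF x] RQ[OF x]
      bounded_ops_in[OF T x] bounded_ops_in[OF bR x] bounded_ops_in[OF bQ x] by simp
  then show "\<exists>Q\<in>finite_rank_ops E F. \<forall>x\<in>carr E. nrm F (T x - Q x) \<le> e * nrm E x"
    using Q by blast
qed (fact T)

lemma finite_rank_approximable:
  assumes "normed_space E" "normed_space F" "T \<in> finite_rank_ops E F"
  shows "T \<in> approximable_ops E F"
proof -
  interpret E: normed_space E by fact
  interpret F: normed_space F by fact
  have "\<forall>x\<in>carr E. nrm F (T x - T x) \<le> e * nrm E x" if "e > 0" for e
    using that E.nrm_nonneg by simp
  moreover have "T \<in> bounded_ops E F" using assms(3) by (simp add: finite_rank_ops_def)
  ultimately show ?thesis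
    unfolding approximable_ops_iff[OF assms(1,2)] using assms(3) by blast
qed

lemma approximable_ops_zero:
  assumes E: "normed_space E" and F: "normed_space F"
  shows "0 \<in> approximable_ops E F"
proof (rule finite_rank_approximable[OF E F])
  have "\<forall>x\<in>carr E. \<exists>a. 0 x = (\<Sum>b\<in>{}. scal F (a b) b)" by simp
  then show "0 \<in> finite_rank_ops E F"
    unfolding finite_rank_ops_def using bounded_ops_zero[OF E F] by blast
qed

lemma finite_rank_add:
  assumes E: "normed_space E" and F: "normed_space F"
    and S: "S \<in> finite_rank_ops E F" and T: "T \<in> finite_rank_ops E F"
  shows "S + T \<in> finite_rank_ops E F"
proof -
  interpret F: normed_space F by fact
  obtain A where A: "finite A" "A \<subseteq> carr F" "\<And>x. x \<in> carr E \<Longrightarrow> \<exists>a. S x = (\<Sum>b\<in>A. scal F (a b) b)"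
    using S unfolding finite_rank_ops_def by blast
  obtain B where B: "finite B" "B \<subseteq> carr F" "\<And>x. x \<in> carr E \<Longrightarrow> \<exists>a. T x = (\<Sum>b\<in>B. scal F (a b) b)"
    using T unfolding finite_rank_ops_def by blast
  have "\<exists>c. (S + T) x = (\<Sum>b\<in>A \<union> B. scal F (c b) b)" if x: "x \<in> carr E" for x
  proof -
    obtain a a' where a: "S x = (\<Sum>b\<in>A. scal F (a b) b)" "T x = (\<Sum>b\<in>B. scal F (a' b) b)"
      using A(3)[OF x] B(3)[OF x] by blast
    have "S x = (\<Sum>b\<in>A \<union> B. scal F (if b \<in> A then a b else 0) b)"
      unfolding a by (rule sum.mono_neutral_cong_left) (use A B in auto)
    moreover have "T x = (\<Sum>b\<in>A \<union> B. scal F (if b \<in> B then a' b else 0) b)"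
      unfolding a by (rule sum.mono_neutral_cong_left) (use A B in auto)
    ultimately have "(S + T) x =
      (\<Sum>b\<in>A \<union> B. scal F ((if b \<in> A then a b else 0) + (if b \<in> B then a' b else 0)) b)"
      by (simp add: sum.distrib F.scale_left_distrib)
    then show ?thesis by (intro exI[of _ "\<lambda>b. (if b \<in> A then a b else 0) + (if b \<in> B then a' b else 0)"])
  qed
  then have "\<forall>x\<in>carr E. \<exists>c. (S + T) x = (\<Sum>b\<in>A \<union> B. scal F (c b) b)" by blast
  moreover have "finite (A \<union> B)" "A \<union> B \<subseteq> carr F" using A(1,2) B(1,2) by auto
  moreover have "S + T \<in> bounded_ops E F"
    using S T by (intro bounded_ops_add[OF E F]) (simp_all add: finite_rank_ops_def)
  ultimately show ?thesis unfolding finite_rank_ops_def by blast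
qed

lemma approximable_ops_add:
  assumes E: "normed_space E" and F: "normed_space F"
    and S: "S \<in> approximable_ops E F" and T: "T \<in> approximable_ops E F"
  shows "S + T \<in> approximable_ops E F"
  unfolding approximable_ops_iff[OF E F]
proof (intro conjI allI impI)
  interpret F: normed_space F by fact
  have S': "S \<in> bounded_ops E F" and T': "T \<in> bounded_ops E F"
    using S T approximable_ops_bounded[OF E F] by auto
  then show "S + T \<in> bounded_ops E F" using bounded_ops_add[OF E F] by blast
  fix e :: real assume e: "0 < e"
  then obtain Q where Q: "Q \<in> finite_rank_ops E F"
    and SQ: "\<And>x. x \<in> carr E \<Longrightarrow> nrm F (S x - Q x) \<le> e/2 * nrm E x"
    using S half_gt_zero[OF e] unfolding approximable_ops_iff[OF E F] by blast
  obtain R where R: "R \<in> finite_rank_ops E F"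
    and TR: "\<And>x. x \<in> carr E \<Longrightarrow> nrm F (T x - R x) \<le> e/2 * nrm E x"
    using T half_gt_zero[OF e] unfolding approximable_ops_iff[OF E F] by blast
  have Q': "Q \<in> bounded_ops E F" and R': "R \<in> bounded_ops E F"
    using Q R by (auto simp: finite_rank_ops_def)
  have "nrm F ((S + T) x - (Q + R) x) \<le> e * nrm E x" if x: "x \<in> carr E" for x
  proof -
    have "nrm F ((S x - Q x) + (T x - R x)) \<le> nrm F (S x - Q x) + nrm F (T x - R x)"
      using x by (intro F.nrm_triangle F.diff_in bounded_ops_in[OF S'] bounded_ops_in[OF T']
          bounded_ops_in[OF Q'] bounded_ops_in[OF R'])
    moreover have "(S x - Q x) + (T x - R x) = (S + T) x - (Q + R) x" by simp
    ultimately show ?thesis using SQ[OF x] TR[OF x] by simp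
  qed
  then show "\<exists>R\<in>finite_rank_ops E F. \<forall>x\<in>carr E. nrm F ((S + T) x - R x) \<le> e * nrm E x"
    using finite_rank_add[OF E F Q R] by blast
qed

lemma approximable_ops_sum:
  assumes E: "normed_space E" and F: "normed_space F"
    and "\<And>i. i \<in> I \<Longrightarrow> T i \<in> approximable_ops E F"
  shows "sum T I \<in> approximable_ops E F"
  using assms(3)
proof (induction I rule: infinite_finite_induct)
  case (insert i I)
  then have "T i + sum T I \<in> approximable_ops E F"
    by (intro approximable_ops_add[OF E F]) simp_all
  then show ?case unfolding sum.insert[OF insert.hyps] .
qed (simp_all only: sum.infinite sum.empty approximable_ops_zero[OF E F] not_False_eq_True)

lemma approximable_ops_comp:
  assumes D: "normed_space D" and E: "normed_space E" and F: "normed_space F"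
    and W: "W \<in> bounded_ops D E" and T: "T \<in> approximable_ops E F"
  shows "T \<circ> W \<in> approximable_ops D F"
  unfolding approximable_ops_iff[OF D F]
proof (intro conjI allI impI)
  show "T \<circ> W \<in> bounded_ops D F"
    using bounded_ops_comp[OF D E W approximable_ops_bounded[OF E F T]] .
  fix e :: real assume e: "0 < e"
  obtain C where C: "C > 0" "\<And>x. x \<in> carr D \<Longrightarrow> nrm E (W x) \<le> C * nrm D x"
    using bounded_ops_bound[OF D W] by blast
  obtain R where R: "R \<in> finite_rank_ops E F"
    and TR: "\<And>x. x \<in> carr E \<Longrightarrow> nrm F (T x - R x) \<le> e/C * nrm E x"
    using divide_pos_pos[OF e C(1)] T approximable_ops_iff[OF E F] by blast
  have "R \<circ> W \<in> finite_rank_ops D F"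
  proof -
    obtain B where "finite B" "B \<subseteq> carr F" "\<forall>x\<in>carr E. \<exists>a. R x = (\<Sum>b\<in>B. scal F (a b) b)"
      and "R \<in> bounded_ops E F"
      using R unfolding finite_rank_ops_def by blast
    then show ?thesis
      using bounded_ops_comp[OF D E W] bounded_ops_in[OF W] unfolding finite_rank_ops_def
      by (auto intro!: exI[of _ B])
  qed
  moreover have "nrm F ((T \<circ> W) x - (R \<circ> W) x) \<le> e * nrm D x" if x: "x \<in> carr D" for x
  proof -
    have "nrm F (T (W x) - R (W x)) \<le> e/C * nrm E (W x)" using TR[OF bounded_ops_in[OF W x]] .
    also have "\<dots> \<le> e/C * (C * nrm D x)" using e C x by (intro mult_left_mono) auto
    finally show ?thesis using C(1) by simp
  qed
  ultimately show "\<exists>R\<in>finite_rank_ops D F. \<forall>x\<in>carr D. nrm F ((T \<circ> W) x - R x) \<le> e * nrm D x"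
    by blast
qed


text \<open>A set contained in a compact subset of a Hausdorff space has compact closure, so it suffices to
  enclose the image of the unit ball in some compact set.\<close>

lemma compact_ops_iff:
  assumes F: "normed_space F"
  shows "T \<in> compact_ops E F \<longleftrightarrow> T \<in> bounded_ops E F \<and>
    (\<exists>K. compactin (ntop F) K \<and> T ` {x \<in> carr E. nrm E x \<le> 1} \<subseteq> K)"
proof -
  interpret F: normed_space F by fact
  have haus: "Hausdorff_space (ntop F)"
    unfolding ntop_def by (rule Metric_space.Hausdorff_space_mtopology[OF F.Metric_space_ndist])
  let ?B = "T ` {x \<in> carr E. nrm E x \<le> 1}"
  have "compactin (ntop F) (ntop F closure_of ?B) \<longleftrightarrow> (\<exists>K. compactin (ntop F) K \<and> ?B \<subseteq> K)"
    if "T \<in> bounded_ops E F"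
  proof
    have "?B \<subseteq> topspace (ntop F)" using bounded_ops_in[OF that] by auto
    then show "\<exists>K. compactin (ntop F) K \<and> ?B \<subseteq> K"
      if "compactin (ntop F) (ntop F closure_of ?B)" using that closure_of_subset by blast
    assume "\<exists>K. compactin (ntop F) K \<and> ?B \<subseteq> K"
    then obtain K where K: "compactin (ntop F) K" "?B \<subseteq> K" by blast
    then show "compactin (ntop F) (ntop F closure_of ?B)"
      by (meson closed_compactin closedin_closure_of closure_of_minimal compactin_imp_closedin haus)
  qed
  then show ?thesis unfolding compact_ops_def by blast
qed

lemma compact_ops_bounded: "T \<in> compact_ops E F \<Longrightarrow> T \<in> bounded_ops E F"
  by (simp add: compact_ops_def)

lemma bounded_ops_continuous_map:
  assumes E: "normed_space E" and F: "normed_space F" and T: "T \<in> bounded_ops E F"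
  shows "continuous_map (ntop E) (ntop F) T"
proof -
  interpret E: normed_space E by fact
  obtain C where C: "C > 0" "\<And>x. x \<in> carr E \<Longrightarrow> nrm F (T x) \<le> C * nrm E x"
    using bounded_ops_bound[OF E T] by blast
  have "continuous_map (ntop (restr E (carr E))) (ntop (restr F (carr F))) T"
  proof (rule continuous_map_Lipschitz[OF E F order_refl order_refl])
    show "T \<in> carr E \<rightarrow> carr F" using bounded_ops_in[OF T] by auto
    show "nrm F (T x - T y) \<le> C * nrm E (x - y)" if "x \<in> carr E" "y \<in> carr E" for x y
      using C(2)[OF E.diff_in[OF that]] linear_map_diff[OF E bounded_ops_linear[OF T] that] by simp
  qed
  then show ?thesis by simp
qed

lemma compact_ops_comp:
  assumes D: "normed_space D" and E: "normed_space E" and F: "normed_space F" and G: "normed_space G"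
    and W: "W \<in> bounded_ops D E" and S: "S \<in> compact_ops E F" and V: "V \<in> bounded_ops F G"
  shows "V \<circ> S \<circ> W \<in> compact_ops D G"
  unfolding compact_ops_iff[OF G]
proof
  interpret E: normed_space E by fact
  interpret G: normed_space G by fact
  have S': "S \<in> bounded_ops E F" using compact_ops_bounded[OF S] .
  have VS: "V \<circ> S \<in> bounded_ops E G" using bounded_ops_comp[OF E F S' V] .
  show "V \<circ> S \<circ> W \<in> bounded_ops D G" using bounded_ops_comp[OF D E W VS] .
  obtain K where K: "compactin (ntop F) K" "S ` {x \<in> carr E. nrm E x \<le> 1} \<subseteq> K"
    using S compact_ops_iff[OF F] by blast
  obtain C where C: "C > 0" "\<And>x. x \<in> carr D \<Longrightarrow> nrm E (W x) \<le> C * nrm D x"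
    using bounded_ops_bound[OF D W] by blast
  \<comment> \<open>\<open>W\<close> maps the unit ball into the ball of radius \<open>C\<close>; the scalar \<open>C\<close> is moved behind \<open>S\<close>.\<close>
  define h where "h = (\<lambda>y. scal G (of_real C) (V y))"
  have "continuous_map (ntop F) (ntop G) h"
    unfolding h_def using bounded_ops_continuous_map[OF F G bounded_ops_scal[OF F G V]] .
  then have "compactin (ntop G) (h ` K)" using K(1) image_compactin by blast
  moreover have "(V \<circ> S \<circ> W) x \<in> h ` K" if x: "x \<in> carr D" "nrm D x \<le> 1" for x
  proof -
    define y where "y = scal E (of_real (1/C)) (W x)"
    have W': "W x \<in> carr E" using bounded_ops_in[OF W x(1)] .
    have y: "y \<in> carr E" using W' by (auto simp: y_def)
    have "nrm E (W x) \<le> C" using C(2)[OF x(1)] x(2) C(1) by (smt (verit) mult_left_le)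
    then have "nrm E y \<le> 1"
      using E.nrm_scal[OF W', of "of_real (1/C)"] C(1) by (simp add: y_def norm_divide)
    then have "S y \<in> K" using K(2) y by blast
    moreover have "(V \<circ> S \<circ> W) x = h (S y)"
    proof -
      have "W x = scal E (of_real C) y"
        using C(1) by (simp add: y_def)
      then show ?thesis
        using linear_map_scal[OF bounded_ops_linear[OF VS] y, of "of_real C"] by (simp add: h_def)
    qed
    ultimately show ?thesis by blast
  qed
  ultimately show "\<exists>K. compactin (ntop G) K \<and> (V \<circ> S \<circ> W) ` {x \<in> carr D. nrm D x \<le> 1} \<subseteq> K"
    by blast
qed

section \<open>Sets of operators conjugate by an invertible operator\<close>

text \<open>This relation is easier to compose and to invert than \<^const>\<open>algebra_isomorphic\<close>, which follows
  from it.\<close>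

definition conjugate_sets ::
  "('k::real_normed_field, 'v::ab_group_add) nspace \<Rightarrow> ('v \<Rightarrow> 'v) set \<Rightarrow> ('v \<Rightarrow> 'v) set \<Rightarrow> bool" where
  "conjugate_sets E A B \<longleftrightarrow>
     (\<exists>U\<in>bounded_ops E E. \<exists>V\<in>bounded_ops E E.
        (\<forall>x\<in>carr E. U (V x) = x) \<and> (\<forall>x\<in>carr E. V (U x) = x) \<and>
        (\<forall>S\<in>A. V \<circ> S \<circ> U \<in> B) \<and> (\<forall>T\<in>B. U \<circ> T \<circ> V \<in> A))"

lemma conjugate_setsI:
  assumes "U \<in> bounded_ops E E" "V \<in> bounded_ops E E"
    and "\<And>x. x \<in> carr E \<Longrightarrow> U (V x) = x" "\<And>x. x \<in> carr E \<Longrightarrow> V (U x) = x"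
    and "\<And>S. S \<in> A \<Longrightarrow> V \<circ> S \<circ> U \<in> B" "\<And>T. T \<in> B \<Longrightarrow> U \<circ> T \<circ> V \<in> A"
  shows "conjugate_sets E A B"
  unfolding conjugate_sets_def
  by (rule bexI[of _ U], rule bexI[of _ V]) (use assms in auto)

lemma conjugate_sets_sym: "conjugate_sets E A B \<Longrightarrow> conjugate_sets E B A"
  unfolding conjugate_sets_def by blast

lemma conjugate_sets_trans:
  assumes E: "normed_space E" and AB: "conjugate_sets E A B" and BC: "conjugate_sets E B C"
  shows "conjugate_sets E A C"
proof -
  obtain U V where U: "U \<in> bounded_ops E E" and V: "V \<in> bounded_ops E E"
    and UV: "\<And>x. x \<in> carr E \<Longrightarrow> U (V x) = x" "\<And>x. x \<in> carr E \<Longrightarrow> V (U x) = x"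
    and S: "\<And>S. S \<in> A \<Longrightarrow> V \<circ> S \<circ> U \<in> B" "\<And>T. T \<in> B \<Longrightarrow> U \<circ> T \<circ> V \<in> A"
    using AB unfolding conjugate_sets_def by (elim bexE conjE) (rule that; blast)
  obtain U' V' where U': "U' \<in> bounded_ops E E" and V': "V' \<in> bounded_ops E E"
    and UV': "\<And>x. x \<in> carr E \<Longrightarrow> U' (V' x) = x" "\<And>x. x \<in> carr E \<Longrightarrow> V' (U' x) = x"
    and S': "\<And>S. S \<in> B \<Longrightarrow> V' \<circ> S \<circ> U' \<in> C" "\<And>T. T \<in> C \<Longrightarrow> U' \<circ> T \<circ> V' \<in> B"
    using BC unfolding conjugate_sets_def by (elim bexE conjE) (rule that; blast)
  show ?thesis
  proof (rule conjugate_setsI)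
    show "U \<circ> U' \<in> bounded_ops E E" "V' \<circ> V \<in> bounded_ops E E"
      using bounded_ops_comp[OF E E] U U' V V' by blast+
    show "(U \<circ> U') ((V' \<circ> V) x) = x" if "x \<in> carr E" for x
      using UV UV' that bounded_ops_in[OF V] by simp
    show "(V' \<circ> V) ((U \<circ> U') x) = x" if "x \<in> carr E" for x
      using UV UV' that bounded_ops_in[OF U'] by simp
    show "V' \<circ> V \<circ> T \<circ> (U \<circ> U') \<in> C" if "T \<in> A" for T
      using S'(1)[OF S(1)[OF that]] by (simp add: comp_assoc)
    show "U \<circ> U' \<circ> T \<circ> (V' \<circ> V) \<in> A" if "T \<in> C" for T
      using S(2)[OF S'(2)[OF that]] by (simp add: comp_assoc)
  qed
qed

text \<open>Continuity is the estimate \<open>\<parallel>V (S - T) U\<parallel> \<le> \<parallel>V\<parallel> \<parallel>S - T\<parallel> \<parallel>U\<parallel>\<close>.\<close>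

lemma conjugation_linear_homeomorphism:
  assumes E: "normed_space E" and AE: "A \<subseteq> bounded_ops E E" and BE: "B \<subseteq> bounded_ops E E"
    and U: "U \<in> bounded_ops E E" and V: "V \<in> bounded_ops E E"
    and AB: "\<And>S. S \<in> A \<Longrightarrow> V \<circ> S \<circ> U \<in> B"
  shows "linear_map (restr (op_space E E) A) (restr (op_space E E) B) (\<lambda>S. V \<circ> S \<circ> U)"
    and "continuous_map (ntop (restr (op_space E E) A)) (ntop (restr (op_space E E) B)) (\<lambda>S. V \<circ> S \<circ> U)"
proof -
  interpret E: normed_space E by fact
  have O: "normed_space (op_space E E)" using normed_space_op_space[OF E E] .
  note lin = linear_map_add[OF bounded_ops_linear[OF V]] linear_map_scal[OF bounded_ops_linear[OF V]]
    linear_map_diff[OF E bounded_ops_linear[OF V]]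
  have inE: "S x \<in> carr E" if "S \<in> A" for S x using that AE bounded_ops_in'[OF E] by blast
  show "linear_map (restr (op_space E E) A) (restr (op_space E E) B) (\<lambda>S. V \<circ> S \<circ> U)"
    unfolding linear_map_def using AB by (auto simp: fun_eq_iff lin inE)
  obtain C where C: "C > 0" "\<And>x. x \<in> carr E \<Longrightarrow> nrm E (U x) \<le> C * nrm E x"
    using bounded_ops_bound[OF E U] by blast
  obtain D where D: "D > 0" "\<And>x. x \<in> carr E \<Longrightarrow> nrm E (V x) \<le> D * nrm E x"
    using bounded_ops_bound[OF E V] by blast
  show "continuous_map (ntop (restr (op_space E E) A)) (ntop (restr (op_space E E) B)) (\<lambda>S. V \<circ> S \<circ> U)"
  proof (rule continuous_map_Lipschitz[OF O O])
    show "A \<subseteq> carr (op_space E E)" "B \<subseteq> carr (op_space E E)" using AE BE by auto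
    show "(\<lambda>S. V \<circ> S \<circ> U) \<in> A \<rightarrow> B" using AB by auto
    fix S T assume S: "S \<in> A" and T: "T \<in> A"
    have ST: "S - T \<in> bounded_ops E E"
      using normed_space.diff_in[OF O, of S T] S T AE by auto
    show "nrm (op_space E E) ((V \<circ> S \<circ> U) - (V \<circ> T \<circ> U)) \<le> (D * C) * nrm (op_space E E) (S - T)"
    proof (rule nrm_op_le[OF E])
      show "0 \<le> D * C * nrm (op_space E E) (S - T)" using C D nrm_op_nonneg[OF E E ST] by simp
      fix x assume x: "x \<in> carr E"
      then have u: "U x \<in> carr E" using bounded_ops_in[OF U] by blast
      have "nrm E (((V \<circ> S \<circ> U) - (V \<circ> T \<circ> U)) x) = nrm E (V ((S - T) (U x)))"
        using S T by (simp add: lin inE)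
      also have "\<dots> \<le> D * nrm E ((S - T) (U x))" using D(2) bounded_ops_in[OF ST u] by blast
      also have "\<dots> \<le> D * (nrm (op_space E E) (S - T) * nrm E (U x))"
        using D(1) nrm_op_bound[OF E E ST u] by simp
      also have "\<dots> \<le> D * (nrm (op_space E E) (S - T) * (C * nrm E x))"
        using D(1) C(2)[OF x] nrm_op_nonneg[OF E E ST] by (simp add: mult_left_mono)
      finally show "nrm E (((V \<circ> S \<circ> U) - (V \<circ> T \<circ> U)) x) \<le> D * C * nrm (op_space E E) (S - T) * nrm E x"
        by (simp add: algebra_simps)
    qed
  qed
qed

lemma conjugate_imp_algebra_isomorphic:
  assumes E: "normed_space E" and AE: "A \<subseteq> bounded_ops E E" and BE: "B \<subseteq> bounded_ops E E"
    and "conjugate_sets E A B"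
  shows "algebra_isomorphic E A B"
proof -
  obtain U V where U: "U \<in> bounded_ops E E" and V: "V \<in> bounded_ops E E"
    and UV: "\<And>x. x \<in> carr E \<Longrightarrow> U (V x) = x" "\<And>x. x \<in> carr E \<Longrightarrow> V (U x) = x"
    and AB: "\<And>S. S \<in> A \<Longrightarrow> V \<circ> S \<circ> U \<in> B" and BA: "\<And>T. T \<in> B \<Longrightarrow> U \<circ> T \<circ> V \<in> A"
    using assms(4) unfolding conjugate_sets_def by (elim bexE conjE) (rule that; blast)
  have O: "normed_space (op_space E E)" using normed_space_op_space[OF E E] .
  have top: "topspace (ntop (restr (op_space E E) Q)) = Q" if "Q \<subseteq> bounded_ops E E" for Q
    using Metric_space.topspace_mtopology[OF normed_space.Metric_space_restr[OF O, of Q]] that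
    by (simp add: ntop_def)
  have inv_conj: "V' \<circ> (U' \<circ> S \<circ> V') \<circ> U' = S"
    if "S \<in> bounded_ops E E" "U' \<in> bounded_ops E E" "V' \<in> bounded_ops E E"
      "\<And>x. x \<in> carr E \<Longrightarrow> V' (U' x) = x" for S U' V'
    by (rule bounded_ops_eqI[of _ E E])
      (use that bounded_ops_in[OF that(1)] in \<open>auto intro!: bounded_ops_comp E\<close>)
  have "homeomorphic_maps (ntop (restr (op_space E E) A)) (ntop (restr (op_space E E) B))
      (\<lambda>S. V \<circ> S \<circ> U) (\<lambda>T. U \<circ> T \<circ> V)"
    unfolding homeomorphic_maps_def top[OF AE] top[OF BE]
    using conjugation_linear_homeomorphism(2)[OF E AE BE U V AB]
      conjugation_linear_homeomorphism(2)[OF E BE AE V U BA]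
      inv_conj[OF _ U V UV(2)] inv_conj[OF _ V U UV(1)] AE BE by blast
  then have "linear_homeomorphism (restr (op_space E E) A) (restr (op_space E E) B) (\<lambda>S. V \<circ> S \<circ> U)"
    using conjugation_linear_homeomorphism(1)[OF E AE BE U V AB]
    unfolding linear_homeomorphism_def homeomorphic_map_maps by blast
  moreover have "V \<circ> (S \<circ> T) \<circ> U = (V \<circ> S \<circ> U) \<circ> (V \<circ> T \<circ> U)" if "S \<in> A" "T \<in> A" for S T
  proof -
    have "T (U x) \<in> carr E" for x using that(2) AE bounded_ops_in'[OF E] by blast
    then show ?thesis by (simp add: fun_eq_iff UV(1))
  qed
  ultimately show ?thesis unfolding algebra_isomorphic_def by blast
qed


section \<open>Finite sums of powers\<close>

lemma powr_convex_combination: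
  fixes p l s t :: real
  assumes p: "1 \<le> p" and l: "0 \<le> l" "l \<le> 1" and "0 \<le> s" "0 \<le> t"
  shows "(l * s + (1 - l) * t) powr p \<le> l * s powr p + (1 - l) * t powr p"
proof -
  have pow: "a powr p \<le> a" if "0 \<le> a" "a \<le> 1" for a :: real
    using powr_mono'[of 1 p a] that p by simp
  consider "s = 0" | "t = 0" | "0 < s" "0 < t" using assms by linarith
  then show ?thesis
  proof cases
    case 1
    then show ?thesis using pow[of "1 - l"] l assms by (simp add: powr_mult mult_right_mono)
  next
    case 2
    then show ?thesis using pow[of l] l assms by (simp add: powr_mult mult_right_mono)
  next
    case 3
    then show ?thesis
      using convex_onD[OF powr_convex[OF p], of "1 - l" s t] l by (simp add: algebra_simps)
  qed
qed

text \<open>After scaling to \<open>a = b = 1\<close> this is convexity of \<open>t \<mapsto> t\<^sup>p\<close>, with the weight \<open>a / (a + b)\<close>.\<close>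

lemma Minkowski_finite_sum:
  fixes u v :: "'i \<Rightarrow> real"
  assumes p: "1 \<le> p" and ab: "0 \<le> a" "0 \<le> b" and uv: "\<And>i. 0 \<le> u i" "\<And>i. 0 \<le> v i"
    and F: "finite F" and u: "(\<Sum>i\<in>F. u i powr p) \<le> a powr p" and v: "(\<Sum>i\<in>F. v i powr p) \<le> b powr p"
  shows "(\<Sum>i\<in>F. (u i + v i) powr p) \<le> (a + b) powr p"
proof -
  have zero: "w i = 0" if "(\<Sum>i\<in>F. w i powr p) \<le> 0 powr p" "i \<in> F" for w :: "'i \<Rightarrow> real" and i
  proof -
    have "(\<Sum>i\<in>F. w i powr p) = 0" using that(1) by (intro antisym sum_nonneg) auto
    then show ?thesis using sum_nonneg_eq_0_iff[OF F, of "\<lambda>i. w i powr p"] that(2) by auto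
  qed
  consider "a = 0" | "b = 0" | "0 < a" "0 < b" using ab by linarith
  then show ?thesis
  proof cases
    case 1
    then have "(\<Sum>i\<in>F. (u i + v i) powr p) = (\<Sum>i\<in>F. v i powr p)"
      using zero[of u] u by (intro sum.cong) auto
    then show ?thesis using v 1 by simp
  next
    case 2
    then have "(\<Sum>i\<in>F. (u i + v i) powr p) = (\<Sum>i\<in>F. u i powr p)"
      using zero[of v] v by (intro sum.cong) auto
    then show ?thesis using u 2 by simp
  next
    case 3
    define l where "l = a / (a + b)"
    have l: "0 \<le> l" "l \<le> 1" and l': "1 - l = b / (a + b)"
      using 3 by (auto simp: l_def field_simps)
    have eq: "u i + v i = (a + b) * (l * (u i / a) + (1 - l) * (v i / b))" for i
    proof -
      have "(a + b) * (l * (u i / a)) = u i" "(a + b) * ((1 - l) * (v i / b)) = v i"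
        unfolding l' using 3 by (auto simp: l_def)
      then show ?thesis by (simp only: distrib_left)
    qed
    have "(\<Sum>i\<in>F. (u i + v i) powr p) \<le>
      (\<Sum>i\<in>F. (a + b) powr p * (l * (u i / a) powr p + (1 - l) * (v i / b) powr p))"
    proof (rule sum_mono)
      fix i assume "i \<in> F"
      have nn: "0 \<le> l * (u i / a) + (1 - l) * (v i / b)"
        using uv ab l by (intro add_nonneg_nonneg mult_nonneg_nonneg divide_nonneg_nonneg) auto
      show "(u i + v i) powr p \<le> (a + b) powr p * (l * (u i / a) powr p + (1 - l) * (v i / b) powr p)"
        unfolding eq powr_mult
        by (intro mult_left_mono powr_convex_combination p l) (use uv 3 in auto)
    qed
    also have "\<dots> = (a + b) powr p * (l * ((\<Sum>i\<in>F. u i powr p) / a powr p) +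
        (1 - l) * ((\<Sum>i\<in>F. v i powr p) / b powr p))"
      using uv 3 by (simp add: powr_divide sum_distrib_left sum.distrib sum_divide_distrib distrib_left)
    also have "\<dots> \<le> (a + b) powr p * (l * 1 + (1 - l) * 1)"
      using u v l 3 by (intro mult_left_mono add_mono) auto
    finally show ?thesis by simp
  qed
qed


lemma sum_powr_le_powr_sum:
  fixes a :: "'i \<Rightarrow> real"
  assumes p: "1 \<le> p" and a: "\<And>i. 0 \<le> a i" and F: "finite F"
  shows "(\<Sum>i\<in>F. a i powr p) \<le> (\<Sum>i\<in>F. a i) powr p"
proof -
  let ?A = "\<Sum>i\<in>F. a i"
  have A: "0 \<le> ?A" using a by (simp add: sum_nonneg)
  have base: "x powr p = x * x powr (p - 1)" if "0 \<le> x" for x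
    using powr_mult_base[OF that, of "p - 1"] by simp
  have "(\<Sum>i\<in>F. a i powr p) = (\<Sum>i\<in>F. a i * a i powr (p - 1))"
    by (rule sum.cong[OF refl]) (rule base[OF a])
  also have "\<dots> \<le> (\<Sum>i\<in>F. a i * ?A powr (p - 1))"
    using p a F by (intro sum_mono mult_left_mono powr_mono2 member_le_sum) auto
  also have "\<dots> = ?A powr p" by (simp add: base[OF A] sum_distrib_right)
  finally show ?thesis .
qed


section \<open>Direct sums of \<open>\<ell>\<^sup>p\<close> type\<close>

locale lp_family =
  fixes p :: real and I :: "'i set" and E :: "'i \<Rightarrow> ('k::real_normed_field, 'v::ab_group_add) nspace"
  assumes p_ge_1: "1 \<le> p" and normed: "\<And>i. normed_space (E i)"
begin

abbreviation "L \<equiv> lp_sum p I E"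

lemma scal_lp: "scal L a z = (\<lambda>i. scal (E i) a (z i))"
  by (simp add: lp_sum_def)

lemma lp_coord: "z \<in> carr L \<Longrightarrow> i \<in> I \<Longrightarrow> z i \<in> carr (E i)"
  and lp_off: "z \<in> carr L \<Longrightarrow> i \<notin> I \<Longrightarrow> z i = 0"
  and lp_summable: "z \<in> carr L \<Longrightarrow> (\<lambda>i. nrm (E i) (z i) powr p) summable_on I"
  by (auto simp: lp_sum_def)

lemma lp_coord': "z \<in> carr L \<Longrightarrow> z i \<in> carr (E i)"
  using lp_coord[of z i] lp_off[of z i] normed_space.zero_in[OF normed, of i] by (cases "i \<in> I") auto

lemma lp_nrm_nonneg: "0 \<le> nrm L z"
  by (simp add: lp_sum_def)

lemma lp_nrm_powr: "nrm L z powr p = (\<Sum>\<^sub>\<infinity>i\<in>I. nrm (E i) (z i) powr p)"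
  using p_ge_1 by (simp add: lp_sum_def powr_powr infsum_nonneg)

lemma lp_finite_sum:
  assumes "z \<in> carr L" "finite F" "F \<subseteq> I"
  shows "(\<Sum>i\<in>F. nrm (E i) (z i) powr p) \<le> nrm L z powr p"
  unfolding lp_nrm_powr by (rule finite_sum_le_infsum) (use assms lp_summable in auto)

text \<open>Membership and norm bounds are both reduced to finite partial sums, where the inequalities for
  finite sums apply.\<close>

lemma lpI:
  assumes in_carr: "\<And>i. i \<in> I \<Longrightarrow> z i \<in> carr (E i)" and off: "\<And>i. i \<notin> I \<Longrightarrow> z i = 0" and M: "0 \<le> M"
    and le: "\<And>F. finite F \<Longrightarrow> F \<subseteq> I \<Longrightarrow> (\<Sum>i\<in>F. nrm (E i) (z i) powr p) \<le> M powr p"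
  shows "z \<in> carr L" and "nrm L z \<le> M"
proof -
  have summable: "(\<lambda>i. nrm (E i) (z i) powr p) summable_on I"
    using le by (intro nonneg_bdd_above_summable_on bdd_aboveI2[of _ _ "M powr p"]) auto
  then show "z \<in> carr L" using in_carr off by (auto simp: lp_sum_def)
  have "nrm L z powr p \<le> M powr p"
    unfolding lp_nrm_powr by (rule infsum_le_finite_sums[OF summable]) (use le in auto)
  then show "nrm L z \<le> M"
    using p_ge_1 M powr_less_mono2[of p M "nrm L z"] by (meson less_le_trans not_le zero_less_one)
qed

lemma lp_coord_le:
  assumes z: "z \<in> carr L"
  shows "nrm (E i) (z i) \<le> nrm L z"
proof (cases "i \<in> I")
  case True
  have "nrm (E i) (z i) powr p \<le> nrm L z powr p"
    using lp_finite_sum[OF z, of "{i}"] True by simp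
  then show ?thesis
    using p_ge_1 lp_nrm_nonneg[of z] powr_less_mono2[of p "nrm L z" "nrm (E i) (z i)"]
    by (meson less_le_trans not_le zero_less_one)
next
  case False
  then show ?thesis
    using lp_off[OF z] lp_nrm_nonneg normed_space.nrm_zero[OF normed] by simp
qed

lemma vector_space_lp: "vector_space (scal L)"
proof -
  interpret V: normed_space "E i" for i by (rule normed)
  show ?thesis
    by unfold_locales (simp_all add: scal_lp fun_eq_iff V.scale_right_distrib V.scale_left_distrib)
qed

lemma lp_add:
  assumes z: "z \<in> carr L" and w: "w \<in> carr L"
  shows "z + w \<in> carr L" and "nrm L (z + w) \<le> nrm L z + nrm L w"
proof -
  interpret V: normed_space "E i" for i by (rule normed)
  have le: "(\<Sum>i\<in>F. nrm (E i) ((z + w) i) powr p) \<le> (nrm L z + nrm L w) powr p"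
    if F: "finite F" "F \<subseteq> I" for F
  proof -
    have "(\<Sum>i\<in>F. nrm (E i) ((z + w) i) powr p) \<le> (\<Sum>i\<in>F. (nrm (E i) (z i) + nrm (E i) (w i)) powr p)"
      using p_ge_1 z w
      by (intro sum_mono powr_mono2) (simp_all add: V.nrm_nonneg V.nrm_triangle V.add_in lp_coord')
    also have "\<dots> \<le> (nrm L z + nrm L w) powr p"
      by (rule Minkowski_finite_sum[OF p_ge_1])
        (use z w F in \<open>auto intro!: lp_nrm_nonneg V.nrm_nonneg lp_coord' lp_finite_sum\<close>)
    finally show ?thesis .
  qed
  show "z + w \<in> carr L" "nrm L (z + w) \<le> nrm L z + nrm L w"
    by (rule lpI[where M = "nrm L z + nrm L w"];
        use z w le lp_nrm_nonneg in \<open>simp add: V.add_in lp_coord lp_off\<close>)+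
qed

lemma lp_scal_le:
  assumes z: "z \<in> carr L"
  shows "scal L a z \<in> carr L" and "nrm L (scal L a z) \<le> norm a * nrm L z"
proof -
  interpret V: normed_space "E i" for i by (rule normed)
  have le: "(\<Sum>i\<in>F. nrm (E i) (scal L a z i) powr p) \<le> (norm a * nrm L z) powr p"
    if F: "finite F" "F \<subseteq> I" for F
  proof -
    have "(\<Sum>i\<in>F. nrm (E i) (scal L a z i) powr p) = norm a powr p * (\<Sum>i\<in>F. nrm (E i) (z i) powr p)"
      using lp_coord'[OF z] V.nrm_nonneg
      by (simp add: scal_lp V.nrm_scal powr_mult sum_distrib_left)
    also have "\<dots> \<le> norm a powr p * nrm L z powr p"
      using lp_finite_sum[OF z F] by (intro mult_left_mono) auto
    finally show ?thesis using lp_nrm_nonneg by (simp add: powr_mult)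
  qed
  show "scal L a z \<in> carr L" "nrm L (scal L a z) \<le> norm a * nrm L z"
    by (rule lpI[where M = "norm a * nrm L z"];
        use le lp_nrm_nonneg in \<open>simp add: scal_lp lp_coord[OF z] lp_off[OF z] V.scal_in\<close>)+
qed

lemma normed_space_lp: "normed_space L"
proof -
  interpret V: normed_space "E i" for i by (rule normed)
  interpret vector_space "scal L" by (rule vector_space_lp)
  have zero: "0 \<in> carr L" "nrm L 0 \<le> 0"
    by (rule lpI[where M = 0]; simp)+
  show ?thesis
  proof
    show "subspace (carr L)"
      unfolding subspace_def using zero lp_add(1) lp_scal_le(1) by blast
    fix z assume z: "z \<in> carr L"
    show "0 \<le> nrm L z" by (rule lp_nrm_nonneg)
    show "nrm L z = 0 \<longleftrightarrow> z = 0"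
    proof
      assume "nrm L z = 0"
      then have "nrm (E i) (z i) = 0" for i
        using lp_coord_le[OF z, of i] V.nrm_nonneg[OF lp_coord'[OF z]] by (metis antisym)
      then show "z = 0" using V.nrm_eq_0_iff lp_coord'[OF z] by (auto simp: fun_eq_iff)
    next
      assume "z = 0"
      then show "nrm L z = 0" using zero(2) lp_nrm_nonneg[of z] by simp
    qed
    show "nrm L (z + w) \<le> nrm L z + nrm L w" if "w \<in> carr L" for w
      using lp_add(2)[OF z that] .
    show "nrm L (scal L a z) = norm a * nrm L z" for a
    proof (cases "a = 0")
      case True
      then show ?thesis using lp_scal_le(2)[OF z, of a] lp_nrm_nonneg[of "scal L a z"] by simp
    next
      case False
      have "nrm L (scal L (inverse a) (scal L a z)) \<le> norm (inverse a) * nrm L (scal L a z)"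
        by (rule lp_scal_le(2)[OF lp_scal_le(1)[OF z]])
      also have "scal L (inverse a) (scal L a z) = z" using False by simp
      finally have "norm a * nrm L z \<le> norm a * (norm (inverse a) * nrm L (scal L a z))"
        by (intro mult_left_mono) simp_all
      also have "\<dots> = nrm L (scal L a z)"
        using False by (simp add: norm_inverse flip: mult.assoc)
      finally have "norm a * nrm L z \<le> nrm L (scal L a z)" .
      then show ?thesis using lp_scal_le(2)[OF z, of a] by simp
    qed
  qed
qed

lemma lp_disjoint_powr:
  assumes z: "z \<in> carr L" and w: "w \<in> carr L" and disj: "\<And>i. z i = 0 \<or> w i = 0"
  shows "nrm L (z + w) powr p \<le> nrm L z powr p + nrm L w powr p"
proof -
  interpret V: normed_space "E i" for i by (rule normed)
  have "nrm (E i) ((z + w) i) powr p = nrm (E i) (z i) powr p + nrm (E i) (w i) powr p" for i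
    using disj[of i] by auto
  then show ?thesis
    unfolding lp_nrm_powr using infsum_add[OF lp_summable[OF z] lp_summable[OF w]] by simp
qed

lemma lp_disjoint_sum_powr:
  assumes "finite A" "\<And>k. k \<in> A \<Longrightarrow> z k \<in> carr L"
    and "\<And>k l i. k \<in> A \<Longrightarrow> l \<in> A \<Longrightarrow> k \<noteq> l \<Longrightarrow> z k i = 0 \<or> z l i = 0"
  shows "nrm L (sum z A) powr p \<le> (\<Sum>k\<in>A. nrm L (z k) powr p)"
  using assms
proof (induction A rule: finite_induct)
  case empty
  then show ?case by (simp only: sum.empty normed_space.nrm_zero[OF normed_space_lp] powr_0)
next
  case (insert a A)
  have app: "sum z A i = (\<Sum>k\<in>A. z k i)" for i
    using insert.hyps(1) by (induction A rule: finite_induct) auto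
  have "z a i = 0 \<or> sum z A i = 0" for i
  proof (cases "z a i = 0")
    case False
    then have "z k i = 0" if "k \<in> A" for k
      using insert.prems(2)[of a k i] insert.hyps(2) that by auto
    then show ?thesis by (simp add: app)
  qed simp
  then have "nrm L (z a + sum z A) powr p \<le> nrm L (z a) powr p + nrm L (sum z A) powr p"
    using insert.prems normed_space.sum_in[OF normed_space_lp, of A z]
    by (intro lp_disjoint_powr) auto
  also have "nrm L (sum z A) powr p \<le> (\<Sum>k\<in>A. nrm L (z k) powr p)"
    by (rule insert.IH) (use insert.prems in auto)
  finally show ?case by (simp only: sum.insert[OF insert.hyps])
qed

end

section \<open>Compact operators on sequence spaces\<close>

definition cutoff :: "nat \<Rightarrow> (nat \<Rightarrow> 'v) \<Rightarrow> nat \<Rightarrow> 'v::zero" where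
  "cutoff n z = (\<lambda>i. if i \<le> n then z i else 0)"

locale lp_sequence = lp_family p I E
  for p and I :: "nat set" and E :: "nat \<Rightarrow> ('k::real_normed_field, 'v::ab_group_add) nspace"
begin

lemma cutoff_in:
  assumes z: "z \<in> carr L"
  shows "cutoff n z \<in> carr L" and "nrm L (cutoff n z) \<le> nrm L z"
proof -
  interpret V: normed_space "E i" for i by (rule normed)
  have le: "(\<Sum>i\<in>F. nrm (E i) (cutoff n z i) powr p) \<le> nrm L z powr p"
    if F: "finite F" "F \<subseteq> I" for F
  proof -
    have "(\<Sum>i\<in>F. nrm (E i) (cutoff n z i) powr p) \<le> (\<Sum>i\<in>F. nrm (E i) (z i) powr p)"
      by (rule sum_mono) (auto simp: cutoff_def)
    also have "\<dots> \<le> nrm L z powr p" by (rule lp_finite_sum[OF z F])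
    finally show ?thesis .
  qed
  show "cutoff n z \<in> carr L" "nrm L (cutoff n z) \<le> nrm L z"
    by (rule lpI[where M = "nrm L z"];
        use le lp_nrm_nonneg lp_off[OF z] lp_coord[OF z] V.zero_in in \<open>simp add: cutoff_def\<close>)+
qed

lemma cutoff_tendsto:
  assumes z: "z \<in> carr L" and e: "0 < e"
  shows "\<exists>N. \<forall>n\<ge>N. nrm L (z - cutoff n z) \<le> e"
proof -
  interpret V: normed_space "E i" for i by (rule normed)
  let ?s = "\<lambda>i. nrm (E i) (z i) powr p"
  have "\<exists>F. finite F \<and> F \<subseteq> I \<and> nrm L z powr p - e powr p < sum ?s F"
  proof (rule ccontr)
    assume "\<not> ?thesis"
    then have "sum ?s F \<le> nrm L z powr p - e powr p" if "finite F" "F \<subseteq> I" for F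
      using that not_less by blast
    then have "infsum ?s I \<le> nrm L z powr p - e powr p"
      by (intro infsum_le_finite_sums lp_summable[OF z])
    then show False using e by (simp add: lp_nrm_powr)
  qed
  then obtain G where G: "finite G" "G \<subseteq> I" "nrm L z powr p - e powr p < sum ?s G" by blast
  obtain N where N: "\<And>i. i \<in> G \<Longrightarrow> i \<le> N" using G(1) unfolding finite_nat_set_iff_bounded_le by blast
  have "nrm L (z - cutoff n z) \<le> e" if n: "n \<ge> N" for n
  proof (rule lpI(2))
    fix F assume F: "finite F" "F \<subseteq> I"
    let ?F = "{i \<in> F. n < i}"
    have "(\<Sum>i\<in>F. nrm (E i) ((z - cutoff n z) i) powr p) = sum ?s ?F"
      by (rule sum.mono_neutral_cong_right)
        (use F(1) V.nrm_zero in \<open>auto simp: cutoff_def not_less\<close>)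
    moreover have "?F \<inter> G = {}" using N n by force
    then have "sum ?s ?F + sum ?s G = sum ?s (?F \<union> G)"
      using F(1) G(1) by (simp add: sum.union_disjoint)
    moreover have "sum ?s (?F \<union> G) \<le> nrm L z powr p"
      by (rule lp_finite_sum[OF z]) (use F G in auto)
    ultimately show "(\<Sum>i\<in>F. nrm (E i) ((z - cutoff n z) i) powr p) \<le> e powr p"
      using G(3) by linarith
  qed (use e lp_off[OF z] lp_coord[OF z] V.zero_in in \<open>simp_all add: cutoff_def\<close>)
  then show ?thesis by blast
qed

text \<open>A gliding hump.  Otherwise there are unit vectors \<open>x\<^sub>1, x\<^sub>2, \<dots>\<close> in disjoint finite blocks with
  \<open>\<parallel>R x\<^sub>k\<parallel> > e\<close>.  By compactness a subsequence of \<open>R x\<^sub>k\<close> converges to some \<open>y\<close>, and \<open>y \<noteq> 0\<close>.  The sum \<open>s\<close>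
  of \<open>n\<close> late members of the subsequence has norm at most \<open>n\<^bsup>1/p\<^esup>\<close>, because the blocks are disjoint, but
  \<open>R s\<close> is close to \<open>n y\<close>, so that its norm grows like \<open>n\<close>.  This is impossible for large \<open>n\<close> as \<open>p > 1\<close>.\<close>

lemma compact_op_small_on_blocks:
  assumes F: "normed_space F" and R: "R \<in> compact_ops L F" and p: "1 < p" and e: "0 < e"
  shows "\<exists>n. \<forall>m. \<forall>z\<in>carr L. (\<forall>i. i \<le> n \<or> m < i \<longrightarrow> z i = 0) \<longrightarrow> nrm F (R z) \<le> e * nrm L z"
proof (rule ccontr)
  interpret F: normed_space F by fact
  interpret L: normed_space L by (rule normed_space_lp)
  have R': "R \<in> bounded_ops L F" using compact_ops_bounded[OF R] .
  note lin = bounded_ops_linear[OF R']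
  assume contra: "\<not> ?thesis"
  define P where "P n m z \<longleftrightarrow> z \<in> carr L \<and> nrm L z = 1 \<and> n \<le> m \<and>
    (\<forall>i. i \<le> n \<or> m < i \<longrightarrow> z i = 0) \<and> e < nrm F (R z)" for n m z
  have "\<exists>m z. P n m z" for n
  proof -
    interpret V: normed_space "E i" for i by (rule normed)
    obtain m z where z: "z \<in> carr L" and supp: "\<And>i. i \<le> n \<or> m < i \<Longrightarrow> z i = 0"
      and less: "e * nrm L z < nrm F (R z)"
      using contra by (meson not_le)
    have "z \<noteq> 0" using less by (auto simp: linear_map_zero[OF normed_space_lp lin])
    then have n0: "nrm L z > 0" using L.nrm_eq_0_iff[OF z] lp_nrm_nonneg[of z] by simp
    define a :: 'k where "a = of_real (1 / nrm L z)"
    have a: "norm a = 1 / nrm L z" unfolding a_def norm_of_real using n0 by simp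
    define w where "w = scal L a z"
    have w: "w \<in> carr L" "nrm L w = 1" using z L.nrm_scal[OF z, of a] n0 by (auto simp: w_def a)
    have "nrm F (R w) = nrm F (R z) / nrm L z"
      unfolding w_def linear_map_scal[OF lin z]
      using F.nrm_scal[OF bounded_ops_in[OF R' z], of a] by (simp add: a)
    then have "e < nrm F (R w)" using less n0 pos_less_divide_eq[OF n0] by simp
    moreover have "w i = 0" if "i \<le> n \<or> max n m < i" for i
      using supp[of i] that by (auto simp: w_def scal_lp)
    ultimately have "P n (max n m) w" using w by (simp add: P_def)
    then show ?thesis by blast
  qed
  then obtain M Z where "\<And>n. P n (M n) (Z n)" by metis
  then have MZ: "\<And>n. Z n \<in> carr L" "\<And>n. nrm L (Z n) = 1" "\<And>n. n \<le> M n"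
    "\<And>n i. i \<le> n \<or> M n < i \<Longrightarrow> Z n i = 0" "\<And>n. e < nrm F (R (Z n))"
    unfolding P_def by auto
  \<comment> \<open>The \<open>k\<close>-th vector lives in the block \<open>N k < i \<le> N (k + 1)\<close>.\<close>
  define N where "N k = (M ^^ k) 0" for k
  define x where "x k = Z (N k)" for k
  have N_mono: "mono N" unfolding mono_iff_le_Suc using MZ(3) by (simp add: N_def)
  have x: "x k \<in> carr L" "nrm L (x k) = 1" "e < nrm F (R (x k))" for k
    using MZ by (auto simp: x_def)
  have disj: "x k i = 0 \<or> x l i = 0" if "k \<noteq> l" for k l i
  proof -
    have *: "x k i = 0 \<or> x l i = 0" if "k < l" for k l
    proof (cases "i \<le> N l")
      case True
      then show ?thesis using MZ(4) by (auto simp: x_def)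
    next
      case False
      moreover have "M (N k) \<le> N l" using monoD[OF N_mono, of "Suc k" l] that by (simp add: N_def)
      ultimately show ?thesis using MZ(4)[where n = "N k" and i = i] by (auto simp: x_def)
    qed
    consider "k < l" | "l < k" using \<open>k \<noteq> l\<close> by linarith
    then show ?thesis using *[of k l] *[of l k] by cases blast+
  qed
  obtain K where K: "compactin (ntop F) K" "R ` {z \<in> carr L. nrm L z \<le> 1} \<subseteq> K"
    using R compact_ops_iff[OF F] by blast
  have "range (\<lambda>k. R (x k)) \<subseteq> K" using K(2) x by auto
  moreover have "\<forall>\<sigma>::nat \<Rightarrow> _. range \<sigma> \<subseteq> K \<longrightarrow>
      (\<exists>l r. l \<in> K \<and> strict_mono r \<and> limitin (ntop F) (\<sigma> \<circ> r) l sequentially)"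
    using K(1) Metric_space.compactin_sequentially[OF F.Metric_space_ndist, of K]
    unfolding ntop_def by blast
  ultimately obtain y r where r: "strict_mono (r :: nat \<Rightarrow> nat)"
    and lim: "limitin (ntop F) ((\<lambda>k. R (x k)) \<circ> r) y sequentially" by blast
  have y: "y \<in> carr F" using lim F.limitin_ntop by blast
  have e4: "0 < e/4" using e by simp
  have "\<forall>\<^sub>F n in sequentially. ((\<lambda>k. R (x k)) \<circ> r) n \<in> carr F \<and> nrm F (((\<lambda>k. R (x k)) \<circ> r) n - y) < e/4"
    using lim e4 unfolding F.limitin_ntop by blast
  then obtain k0 where k0: "\<And>k. k \<ge> k0 \<Longrightarrow> nrm F (R (x (r k)) - y) < e/4"
    unfolding eventually_sequentially comp_def by blast
  have Rx: "R (x k) \<in> carr F" for k using bounded_ops_in[OF R'] x(1) by blast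
  \<comment> \<open>\<open>y\<close> is within \<open>e/4\<close> of vectors of norm greater than \<open>e\<close>.\<close>
  have y_ge: "3/4 * e \<le> nrm F y"
  proof -
    have "nrm F ((R (x (r k0)) - y) + y) \<le> nrm F (R (x (r k0)) - y) + nrm F y"
      by (intro F.nrm_triangle F.diff_in Rx y)
    then show ?thesis using x(3)[of "r k0"] k0[OF order_refl] by simp
  qed
  obtain C where C: "C > 0" "\<And>z. z \<in> carr L \<Longrightarrow> nrm F (R z) \<le> C * nrm L z"
    using bounded_ops_bound[OF normed_space_lp R'] by blast
  define a where "a = 2 * C / e"
  have a: "a > 0" using C e by (simp add: a_def)
  \<comment> \<open>The sum of \<open>n\<close> humps will give \<open>n\<^sup>p \<le> a\<^sup>p n\<close>; this \<open>n\<close> is too large for that.\<close>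
  obtain n :: nat where n: "(a powr p) powr (1 / (p - 1)) < real n" using reals_Archimedean2 by blast
  then have n0: "0 < real n" using powr_ge_zero[of "a powr p" "1 / (p - 1)"] by linarith
  let ?J = "{k0..<k0 + n}"
  define s where "s = (\<Sum>k\<in>?J. x (r k))"
  have s: "s \<in> carr L" unfolding s_def by (rule L.sum_in) (rule x)
  have "nrm L s powr p \<le> (\<Sum>k\<in>?J. nrm L (x (r k)) powr p)"
    unfolding s_def
  proof (rule lp_disjoint_sum_powr)
    show "x (r k) i = 0 \<or> x (r l) i = 0" if "k \<noteq> l" for k l i
      using disj strict_mono_eq[OF r] that by blast
  qed (auto intro: x)
  then have s_le: "nrm L s powr p \<le> real n" by (simp add: x)
  have Rs: "R s = (\<Sum>k\<in>?J. R (x (r k)))"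
    unfolding s_def by (rule linear_map_sum[OF normed_space_lp lin]) (rule x)
  have "R s = (\<Sum>k\<in>?J. R (x (r k)) - y) + scal F (of_nat n) y"
    by (simp add: Rs sum_subtractf F.sum_constant_scale)
  then have "scal F (of_nat n) y = R s - (\<Sum>k\<in>?J. R (x (r k)) - y)" by simp
  moreover have "nrm F (R s - (\<Sum>k\<in>?J. R (x (r k)) - y)) \<le> nrm F (R s) + nrm F (\<Sum>k\<in>?J. R (x (r k)) - y)"
    by (intro F.nrm_diff_le bounded_ops_in[OF R' s] F.sum_in F.diff_in Rx y)
  moreover have "nrm F (\<Sum>k\<in>?J. R (x (r k)) - y) \<le> (\<Sum>k\<in>?J. nrm F (R (x (r k)) - y))"
    by (intro F.nrm_sum F.diff_in Rx y) simp
  moreover have "(\<Sum>k\<in>?J. nrm F (R (x (r k)) - y)) \<le> (\<Sum>k\<in>?J. e/4)"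
    by (intro sum_mono less_imp_le[OF k0]) simp
  ultimately have "real n * nrm F y \<le> nrm F (R s) + real n * e/4"
    using F.nrm_scal[OF y, of "of_nat n"] by simp
  moreover have "real n * (3/4 * e) \<le> real n * nrm F y" using y_ge by (intro mult_left_mono) auto
  moreover have "nrm F (R s) \<le> C * nrm L s" using C(2)[OF s] .
  ultimately have "real n * e / 2 \<le> C * nrm L s" by (simp add: field_simps)
  then have "real n \<le> a * nrm L s" using e by (simp add: a_def field_simps)
  then have "real n powr p \<le> (a * nrm L s) powr p" using p by (intro powr_mono2) auto
  also have "\<dots> = a powr p * nrm L s powr p" using a lp_nrm_nonneg by (simp add: powr_mult)
  also have "\<dots> \<le> a powr p * real n" using s_le by (intro mult_left_mono) auto
  finally have "real n powr p / real n \<le> a powr p" using n0 by (simp add: field_simps)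
  then have "real n powr (p - 1) \<le> a powr p" using n0 by (simp add: powr_diff)
  moreover have "a powr p = ((a powr p) powr (1 / (p - 1))) powr (p - 1)"
    using p a by (simp add: powr_powr)
  moreover have "\<dots> < real n powr (p - 1)" using n p by (intro powr_less_mono2) auto
  ultimately show False by linarith
qed

text \<open>The estimate for finitely supported vectors passes to all vectors, as these are limits of
  their cutoffs.\<close>

lemma compact_op_small_on_tails:
  assumes F: "normed_space F" and R: "R \<in> compact_ops L F" and p: "1 < p" and e: "0 < e"
  shows "\<exists>n. \<forall>z\<in>carr L. (\<forall>i\<le>n. z i = 0) \<longrightarrow> nrm F (R z) \<le> e * nrm L z"
proof -
  interpret F: normed_space F by fact
  interpret L: normed_space L by (rule normed_space_lp)
  have R': "R \<in> bounded_ops L F" using compact_ops_bounded[OF R] .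
  obtain n where n: "\<forall>m. \<forall>z\<in>carr L. (\<forall>i. i \<le> n \<or> m < i \<longrightarrow> z i = 0) \<longrightarrow> nrm F (R z) \<le> e * nrm L z"
    using compact_op_small_on_blocks[OF assms] by blast
  obtain C where C: "C > 0" "\<And>z. z \<in> carr L \<Longrightarrow> nrm F (R z) \<le> C * nrm L z"
    using bounded_ops_bound[OF normed_space_lp R'] by blast
  have "nrm F (R z) \<le> e * nrm L z" if z: "z \<in> carr L" and z0: "\<And>i. i \<le> n \<Longrightarrow> z i = 0" for z
  proof (rule field_le_epsilon)
    fix d :: real assume d: "0 < d"
    then obtain N where N: "nrm L (z - cutoff N z) \<le> d / C"
      using cutoff_tendsto[OF z, of "d / C"] C(1) by auto
    let ?t = "cutoff N z"
    have t: "?t \<in> carr L" "nrm L ?t \<le> nrm L z" using cutoff_in[OF z] by auto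
    have "R z = R (z - ?t) + R ?t"
      using linear_map_diff[OF normed_space_lp bounded_ops_linear[OF R'] z t(1)] by simp
    also have "nrm F \<dots> \<le> nrm F (R (z - ?t)) + nrm F (R ?t)"
      by (intro F.nrm_triangle bounded_ops_in[OF R'] L.diff_in z t)
    also have "nrm F (R (z - ?t)) \<le> C * (d / C)"
      using C(2)[OF L.diff_in[OF z t(1)]] N C(1) mult_left_mono[OF N, of C] by linarith
    also have "nrm F (R ?t) \<le> e * nrm L ?t"
      by (rule n[rule_format, OF t(1), of N]) (use z0 in \<open>auto simp: cutoff_def\<close>)
    also have "\<dots> \<le> e * nrm L z" using t(2) e by simp
    finally show "nrm F (R z) \<le> e * nrm L z + d" using C(1) by simp
  qed
  then show ?thesis by blast
qed

end


section \<open>Operators on the sum of \<open>Y\<close> and countably many copies of \<open>X\<close>\<close>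

lemma id_bounded_op:
  assumes "normed_space E"
  shows "(\<lambda>x. if x \<in> carr E then x else 0) \<in> bounded_ops E E"
proof -
  interpret E: normed_space E by fact
  show ?thesis
    by (rule bounded_opsI[where C = 1]) (auto simp: linear_map_def E.add_in E.scal_in)
qed

lemma compact_ops_comp_left:
  assumes E: "normed_space E" and F: "normed_space F" and G: "normed_space G"
    and S: "S \<in> compact_ops E F" and V: "V \<in> bounded_ops F G"
  shows "V \<circ> S \<in> compact_ops E G"
proof -
  have "S \<circ> (\<lambda>x. if x \<in> carr E then x else 0) = S"
    using bounded_ops_off[OF compact_ops_bounded[OF S]] normed_space.zero_in[OF E]
      linear_map_zero[OF E bounded_ops_linear[OF compact_ops_bounded[OF S]]]
    by (auto simp: fun_eq_iff)
  then show ?thesis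
    using compact_ops_comp[OF E E F G id_bounded_op[OF E] S V] by (simp only: comp_assoc)
qed

text \<open>Both maps are cut down to be \<open>0\<close> off the carriers, as membership in \<^const>\<open>bounded_ops\<close> requires.\<close>

lemma linear_homeomorphism_bounded_inverse:
  assumes E: "normed_space E" and F: "normed_space F" and "linear_homeomorphism E F h"
  obtains f g where "f \<in> bounded_ops E F" "g \<in> bounded_ops F E"
    "\<And>x. x \<in> carr E \<Longrightarrow> g (f x) = x" "\<And>y. y \<in> carr F \<Longrightarrow> f (g y) = y"
proof -
  interpret E: normed_space E by fact
  interpret F: normed_space F by fact
  have lin: "linear_map E F h"
    using assms(3) by (simp add: linear_homeomorphism_def)
  obtain k where "homeomorphic_maps (ntop E) (ntop F) h k"
    using assms(3) unfolding linear_homeomorphism_def homeomorphic_map_maps by blast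
  then have cont: "continuous_map (ntop E) (ntop F) h" "continuous_map (ntop F) (ntop E) k"
    and inv: "\<And>x. x \<in> carr E \<Longrightarrow> k (h x) = x" "\<And>y. y \<in> carr F \<Longrightarrow> h (k y) = y"
    by (simp_all add: homeomorphic_maps_def)
  have k_in: "k y \<in> carr E" if "y \<in> carr F" for y
    using continuous_map_image_subset_topspace[OF cont(2)] that by auto
  have "k (x + y) = k x + k y" if "x \<in> carr F" "y \<in> carr F" for x y
    using inv(1)[OF E.add_in[OF k_in k_in], of x y] that
      linear_map_add[OF lin k_in k_in, of x y] inv(2) by simp
  moreover have "k (scal F a x) = scal E a (k x)" if "x \<in> carr F" for a x
    using inv(1)[OF E.scal_in[OF k_in], of x a] that linear_map_scal[OF lin k_in, of x a] inv(2) by simp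
  ultimately have lin': "linear_map F E k" using k_in by (simp add: linear_map_def)
  obtain C where C: "\<forall>x\<in>carr E. nrm F (h x) \<le> C * nrm E x"
    using linear_map_continuous_bounded[OF E F lin cont(1)] by blast
  obtain D where D: "\<forall>x\<in>carr F. nrm E (k x) \<le> D * nrm F x"
    using linear_map_continuous_bounded[OF F E lin' cont(2)] by blast
  show thesis
  proof
    show "(\<lambda>x. if x \<in> carr E then h x else 0) \<in> bounded_ops E F"
      by (rule bounded_opsI[where C = C]) (use lin C in \<open>auto simp: linear_map_def\<close>)
    show "(\<lambda>x. if x \<in> carr F then k x else 0) \<in> bounded_ops F E"
      by (rule bounded_opsI[where C = D]) (use lin' D in \<open>auto simp: linear_map_def\<close>)
  qed (use inv k_in linear_map_in[OF lin] in auto)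
qed


locale Z_sum =
  fixes p :: real and X Y :: "('k::real_normed_field, 'v::ab_group_add) nspace"
  assumes p: "1 < p" and X: "normed_space X" and Y: "normed_space Y"
begin

abbreviation "Z \<equiv> Z_space p X Y"
abbreviation "J \<equiv> Z_incl X Y"
abbreviation "P \<equiv> Z_proj p X Y"
abbreviation "Zc \<equiv> Z_comp X Y"

sublocale X: normed_space X by (rule X)
sublocale Y: normed_space Y by (rule Y)

lemma normed_Z_comp: "normed_space (Zc j)"
  using X Y by (simp add: Z_comp_def)

sublocale comp: normed_space "Zc j" for j by (rule normed_Z_comp)

sublocale lp: lp_sequence p UNIV Zc
  by unfold_locales (use p normed_Z_comp in auto)

lemmas Z_coord = lp.lp_coord'[folded Z_space_def]
  and ZI = lp.lpI[folded Z_space_def, simplified]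
  and Z_finite_sum = lp.lp_finite_sum[folded Z_space_def, simplified]
  and Z_summable = lp.lp_summable[folded Z_space_def]
  and Z_nrm_powr = lp.lp_nrm_powr[folded Z_space_def]
  and Z_coord_le = lp.lp_coord_le[folded Z_space_def]
  and Z_nrm_nonneg = lp.lp_nrm_nonneg[folded Z_space_def]
  and cutoff_in = lp.cutoff_in[folded Z_space_def]
  and cutoff_tendsto = lp.cutoff_tendsto[folded Z_space_def]
  and small_on_tails = lp.compact_op_small_on_tails[folded Z_space_def]
  and scal_Z = lp.scal_lp[folded Z_space_def]

lemma Z: "normed_space Z"
  unfolding Z_space_def by (rule lp.normed_space_lp)

sublocale Z: normed_space Z by (rule Z)

lemma Z_comp_0 [simp]: "Zc 0 = Y" and Z_comp_pos [simp]: "0 < j \<Longrightarrow> Zc j = X"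
  by (simp_all add: Z_comp_def)

lemma proj_apply: "z \<in> carr Z \<Longrightarrow> P j z = z j"
  by (simp add: Z_proj_def)

lemma proj_bounded: "P j \<in> bounded_ops Z (Zc j)"
proof (rule bounded_opsI[where C = 1])
  show "linear_map Z (Zc j) (P j)"
    by (auto simp: linear_map_def Z_proj_def Z_coord Z.add_in Z.scal_in) (simp add: scal_Z)
qed (auto simp: Z_proj_def Z_coord_le)

lemma incl_in:
  shows "J k x \<in> carr Z" and "x \<in> carr (Zc k) \<Longrightarrow> nrm Z (J k x) \<le> nrm (Zc k) x"
proof -
  have *: "J k x \<in> carr Z \<and> nrm Z (J k x) \<le> nrm (Zc k) x" if x: "x \<in> carr (Zc k)"
  proof -
    have le: "(\<Sum>i\<in>F. nrm (Zc i) (J k x i) powr p) \<le> nrm (Zc k) x powr p" if F: "finite F" for F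
    proof -
      have "(\<Sum>i\<in>F. nrm (Zc i) (J k x i) powr p) = (\<Sum>i\<in>F. if i = k then nrm (Zc k) x powr p else 0)"
        by (rule sum.cong) (use x p in \<open>auto simp: Z_incl_def\<close>)
      also have "\<dots> \<le> nrm (Zc k) x powr p" using F by (simp add: sum.delta)
      finally show ?thesis .
    qed
    have in_comp: "J k x i \<in> carr (Zc i)" for i by (simp add: Z_incl_def)
    show ?thesis
      using ZI[of "J k x" "nrm (Zc k) x", OF in_comp comp.nrm_nonneg[OF x] le] by simp
  qed
  then show "x \<in> carr (Zc k) \<Longrightarrow> nrm Z (J k x) \<le> nrm (Zc k) x" by blast
  show "J k x \<in> carr Z"
  proof (cases "x \<in> carr (Zc k)")
    case False
    then have "J k x = 0" by (simp add: Z_incl_def fun_eq_iff)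
    then show ?thesis by (simp only: Z.zero_in)
  qed (use * in blast)
qed

lemma incl_bounded: "J k \<in> bounded_ops (Zc k) Z"
proof (rule bounded_opsI[where C = 1])
  show "linear_map (Zc k) Z (J k)"
    unfolding linear_map_def
  proof (intro conjI ballI allI)
    show "J k \<in> carr (Zc k) \<rightarrow> carr Z" using incl_in(1) by blast
    show "J k (x + y) = J k x + J k y" if "x \<in> carr (Zc k)" "y \<in> carr (Zc k)" for x y
      using that by (auto simp: Z_incl_def fun_eq_iff comp.add_in)
    show "J k (scal (Zc k) a x) = scal Z a (J k x)" if "x \<in> carr (Zc k)" for a x
      using that by (auto simp: Z_incl_def fun_eq_iff scal_Z comp.scal_in)
  qed
qed (auto simp: incl_in, simp add: Z_incl_def fun_eq_iff)

lemma cutoff_eq_sum: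
  assumes z: "z \<in> carr Z" and A: "finite A" and AB: "\<And>i. z i \<noteq> 0 \<Longrightarrow> i \<le> n \<Longrightarrow> i \<in> A" "\<And>i. i \<in> A \<Longrightarrow> i \<le> n"
  shows "cutoff n z = (\<Sum>m\<in>A. J m (z m))"
proof
  fix i
  have "(\<Sum>m\<in>A. J m (z m)) i = (\<Sum>m\<in>A. J m (z m) i)"
    using A by (induction A rule: finite_induct) auto
  also have "\<dots> = (\<Sum>m\<in>A. if m = i then z i else 0)"
    by (rule sum.cong) (auto simp: Z_incl_def Z_coord[OF z])
  also have "\<dots> = cutoff n z i"
    using A AB[of i] by (auto simp: cutoff_def)
  finally show "cutoff n z i = (\<Sum>m\<in>A. J m (z m)) i" by simp
qed

text \<open>Since \<open>R\<close> is small on tails, \<open>R \<circ> W\<close> is the limit in operator norm of the finite sums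
  \<open>\<Sum>\<^sub>m (R \<circ> J m) \<circ> (P m \<circ> W)\<close> over \<open>m \<in> B\<close> with \<open>m \<le> n\<close>, each of which is approximable because composing an
  approximable operator with a bounded one keeps it approximable.\<close>

lemma column_operator_approximable:
  assumes R: "R \<in> compact_ops Z Y" and W: "W \<in> bounded_ops X Z" and B: "0 \<notin> B"
    and cols: "\<And>k. k \<in> B \<Longrightarrow> R \<circ> J k \<in> approximable_ops X Y"
    and supp: "\<And>x m. x \<in> carr X \<Longrightarrow> m \<notin> B \<Longrightarrow> W x m = 0"
  shows "R \<circ> W \<in> approximable_ops X Y"
proof (rule approximable_ops_limit[OF X Y])
  have R': "R \<in> bounded_ops Z Y" using compact_ops_bounded[OF R] .
  show "R \<circ> W \<in> bounded_ops X Y" using bounded_ops_comp[OF X Z W R'] .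
  obtain C where C: "C > 0" "\<forall>x\<in>carr X. nrm Z (W x) \<le> C * nrm X x"
    using bounded_ops_bound[OF X W] by blast
  fix e :: real assume e: "0 < e"
  obtain n where n: "\<forall>z\<in>carr Z. (\<forall>i\<le>n. z i = 0) \<longrightarrow> nrm Y (R z) \<le> e / C * nrm Z z"
    using small_on_tails[OF Y R p divide_pos_pos[OF e C(1)]] by blast
  define A where "A = {m \<in> B. m \<le> n}"
  have A: "finite A" unfolding A_def by simp
  define T where "T = (\<Sum>m\<in>A. (R \<circ> J m) \<circ> (P m \<circ> W))"
  have "T \<in> approximable_ops X Y"
    unfolding T_def
  proof (rule approximable_ops_sum[OF X Y])
    fix m assume m: "m \<in> A"
    then have "Zc m = X" using B by (cases m) (auto simp: A_def)
    then have "P m \<circ> W \<in> bounded_ops X X"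
      using bounded_ops_comp[OF X Z W proj_bounded[of m]] by simp
    then show "R \<circ> J m \<circ> (P m \<circ> W) \<in> approximable_ops X Y"
      using m by (intro approximable_ops_comp[OF X X Y] cols) (simp_all add: A_def)
  qed
  moreover have "nrm Y ((R \<circ> W) x - T x) \<le> e * nrm X x" if x: "x \<in> carr X" for x
  proof -
    have w: "W x \<in> carr Z" using bounded_ops_in[OF W x] .
    have "T x = (\<Sum>m\<in>A. R (J m (W x m)))"
      unfolding T_def using A
      by (induction A rule: finite_induct) (auto simp: proj_apply[OF w])
    also have "\<dots> = R (\<Sum>m\<in>A. J m (W x m))"
      by (rule linear_map_sum[OF Z bounded_ops_linear[OF R'], symmetric]) (rule incl_in)
    also have "(\<Sum>m\<in>A. J m (W x m)) = cutoff n (W x)"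
    proof (rule cutoff_eq_sum[OF w A, symmetric])
      show "i \<in> A" if "W x i \<noteq> 0" "i \<le> n" for i using that supp[OF x, of i] by (auto simp: A_def)
    qed (simp add: A_def)
    finally have "(R \<circ> W) x - T x = R (W x - cutoff n (W x))"
      using linear_map_diff[OF Z bounded_ops_linear[OF R'] w cutoff_in(1)[OF w]] by simp
    also have "nrm Y \<dots> \<le> e / C * nrm Z (W x - cutoff n (W x))"
      using n[rule_format, OF Z.diff_in[OF w cutoff_in(1)[OF w, of n]]] by (simp add: cutoff_def)
    also have "\<dots> \<le> e / C * nrm Z (W x)"
    proof (rule mult_left_mono)
      show "nrm Z (W x - cutoff n (W x)) \<le> nrm Z (W x)"
      proof (rule ZI(2)[OF _ Z_nrm_nonneg])
        show "(W x - cutoff n (W x)) i \<in> carr (Zc i)" for i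
          using Z_coord[OF w, of i] comp.zero_in[of i]
          by (cases "i \<le> n") (simp_all add: cutoff_def del: Z_comp_pos)
        fix F :: "nat set" assume F: "finite F"
        have "(\<Sum>i\<in>F. nrm (Zc i) ((W x - cutoff n (W x)) i) powr p) \<le> (\<Sum>i\<in>F. nrm (Zc i) (W x i) powr p)"
          by (rule sum_mono) (simp add: cutoff_def)
        also have "\<dots> \<le> nrm Z (W x) powr p" by (rule Z_finite_sum[OF w F])
        finally show "(\<Sum>i\<in>F. nrm (Zc i) ((W x - cutoff n (W x)) i) powr p) \<le> nrm Z (W x) powr p" .
      qed
    qed (use e C in simp)
    also have "\<dots> \<le> e / C * (C * nrm X x)" using C x e by (intro mult_left_mono) auto
    finally show ?thesis using C(1) by simp
  qed
  ultimately show "\<exists>T\<in>approximable_ops X Y. \<forall>x\<in>carr X. nrm Y ((R \<circ> W) x - T x) \<le> e * nrm X x"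
    by blast
qed

text \<open>The operator \<open>\<psi>\<^sub>c\<close>.  Its zeroth coordinate is \<open>0\<close>, whatever the value \<open>c 0\<close>.\<close>

definition diag :: "(nat \<Rightarrow> 'k) \<Rightarrow> 'v \<Rightarrow> nat \<Rightarrow> 'v" where
  "diag c x = (\<lambda>i. if i = 0 \<or> x \<notin> carr X then 0 else scal X (c i) x)"

text \<open>The norm is at most the \<open>\<ell>\<^sup>1\<close>-norm of \<open>c\<close>, because the \<open>\<ell>\<^sup>p\<close>-norm is dominated by the \<open>\<ell>\<^sup>1\<close>-norm.\<close>

lemma diag_bounded:
  assumes c: "c \<in> ell1"
  shows "diag c \<in> bounded_ops X Z"
proof -
  define M where "M = (\<Sum>\<^sub>\<infinity>i\<in>{1..}. norm (c i))"
  have M: "0 \<le> M" unfolding M_def by (rule infsum_nonneg) simp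
  have le: "(\<Sum>i\<in>F. nrm (Zc i) (diag c x i) powr p) \<le> (M * nrm X x) powr p"
    if x: "x \<in> carr X" and F: "finite F" for F x
  proof -
    let ?F = "F - {0}"
    have "(\<Sum>i\<in>F. nrm (Zc i) (diag c x i) powr p) = (\<Sum>i\<in>?F. (norm (c i) * nrm X x) powr p)"
      by (rule sum.mono_neutral_cong_right) (use F x p in \<open>auto simp: diag_def X.nrm_scal\<close>)
    also have "\<dots> \<le> (\<Sum>i\<in>?F. norm (c i) * nrm X x) powr p"
      using p F X.nrm_nonneg[OF x] by (intro sum_powr_le_powr_sum) auto
    also have "(\<Sum>i\<in>?F. norm (c i) * nrm X x) = (\<Sum>i\<in>?F. norm (c i)) * nrm X x"
      by (simp add: sum_distrib_right)
    also have "\<dots> powr p \<le> (M * nrm X x) powr p"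
    proof (intro powr_mono2 mult_right_mono)
      show "(\<Sum>i\<in>?F. norm (c i)) \<le> M"
        unfolding M_def by (rule finite_sum_le_infsum) (use c F in \<open>auto simp: ell1_def\<close>)
    qed (use p X.nrm_nonneg[OF x] in \<open>auto intro!: mult_nonneg_nonneg sum_nonneg\<close>)
    finally show ?thesis .
  qed
  have in_comp: "diag c x i \<in> carr (Zc i)" for x i
    by (auto simp: diag_def)
  have *: "diag c x \<in> carr Z \<and> nrm Z (diag c x) \<le> M * nrm X x" if x: "x \<in> carr X" for x
    using ZI[of "diag c x", OF in_comp mult_nonneg_nonneg[OF M X.nrm_nonneg[OF x]] le[OF x]] by simp
  show ?thesis
  proof (rule bounded_opsI)
    show "linear_map X Z (diag c)"
      using * by (auto simp: linear_map_def diag_def fun_eq_iff scal_Z X.add_in X.scal_in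
          X.scale_right_distrib X.scale_left_commute)
    show "nrm Z (diag c x) \<le> M * nrm X x" if "x \<in> carr X" for x using * that by blast
    show "diag c x = 0" if "x \<notin> carr X" for x using that by (simp add: diag_def fun_eq_iff)
  qed
qed

text \<open>The partial sums are the values of \<open>R\<close> at the cutoffs of \<open>diag c x\<close>.\<close>

lemma limitin_series_operator:
  assumes R: "R \<in> bounded_ops Z Y" and c: "c \<in> ell1" and x: "x \<in> carr X"
  shows "limitin (ntop Y) (\<lambda>n. \<Sum>r=1..n. scal Y (c r) (R (J r x))) (R (diag c x)) sequentially"
proof -
  note lin = bounded_ops_linear[OF R]
  let ?w = "diag c x"
  have w: "?w \<in> carr Z" using bounded_ops_in[OF diag_bounded[OF c] x] .
  obtain C where C: "C > 0" "\<forall>z\<in>carr Z. nrm Y (R z) \<le> C * nrm Z z"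
    using bounded_ops_bound[OF Z R] by blast
  have eq: "(\<Sum>r=1..n. scal Y (c r) (R (J r x))) = R (cutoff n ?w)" for n
  proof -
    have "(\<Sum>r=1..n. scal Y (c r) (R (J r x))) = (\<Sum>r=1..n. R (J r (?w r)))"
    proof (rule sum.cong[OF refl])
      fix r assume r: "r \<in> {1..n}"
      then have "J r (?w r) = scal Z (c r) (J r x)"
        using x by (auto simp: Z_incl_def diag_def scal_Z fun_eq_iff X.scal_in)
      then show "scal Y (c r) (R (J r x)) = R (J r (?w r))"
        using linear_map_scal[OF lin incl_in(1)] by simp
    qed
    also have "\<dots> = R (\<Sum>r=1..n. J r (?w r))"
      by (rule linear_map_sum[OF Z lin, symmetric]) (rule incl_in)
    also have "(\<Sum>r=1..n. J r (?w r)) = cutoff n ?w"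
      by (rule cutoff_eq_sum[OF w, symmetric]) (auto simp: diag_def split: if_splits)
    finally show ?thesis .
  qed
  show ?thesis
    unfolding Y.limitin_ntop eq
  proof (intro conjI allI impI)
    show "R ?w \<in> carr Y" using bounded_ops_in[OF R w] .
    fix e :: real assume e: "0 < e"
    then have "0 < e / (2 * C)" using C(1) by simp
    then obtain N where N: "\<forall>n\<ge>N. nrm Z (?w - cutoff n ?w) \<le> e / (2 * C)"
      using cutoff_tendsto[OF w] by blast
    have "R (cutoff n ?w) \<in> carr Y \<and> nrm Y (R (cutoff n ?w) - R ?w) < e" if "N \<le> n" for n
    proof
      have t: "cutoff n ?w \<in> carr Z" using cutoff_in(1)[OF w] .
      then show Rt: "R (cutoff n ?w) \<in> carr Y" using bounded_ops_in[OF R] by blast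
      have "nrm Y (R (cutoff n ?w) - R ?w) = nrm Y (R ?w - R (cutoff n ?w))"
        by (rule Y.nrm_diff_commute[OF Rt bounded_ops_in[OF R w]])
      also have "\<dots> = nrm Y (R (?w - cutoff n ?w))" using linear_map_diff[OF Z lin w t] by simp
      also have "\<dots> \<le> C * nrm Z (?w - cutoff n ?w)" using C(2) Z.diff_in[OF w t] by blast
      also have "\<dots> \<le> C * (e / (2 * C))" using N that C(1) by (intro mult_left_mono) auto
      also have "\<dots> < e" using C(1) e by simp
      finally show "nrm Y (R (cutoff n ?w) - R ?w) < e" .
    qed
    then show "\<forall>\<^sub>F n in sequentially. R (cutoff n ?w) \<in> carr Y \<and> nrm Y (R (cutoff n ?w) - R ?w) < e"
      unfolding eventually_sequentially by blast
  qed
qed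

lemma row_bounded: "S \<in> bounded_ops Z Z \<Longrightarrow> P 0 \<circ> S \<in> bounded_ops Z Y"
  using bounded_ops_comp[OF Z Z _ proj_bounded[of 0]] by simp

lemma row_compact: "S \<in> compact_ops Z Z \<Longrightarrow> P 0 \<circ> S \<in> compact_ops Z Y"
  using compact_ops_comp_left[OF Z Z Y _ proj_bounded[of 0, simplified]] .

text \<open>By uniqueness of limits the operator \<open>T\<close> in the definition of \<^const>\<open>I_seq\<close> can only be
  \<open>P 0 \<circ> S \<circ> diag c\<close>.\<close>

lemma I_seq_iff:
  assumes c: "c \<in> ell1"
  shows "S \<in> I_seq p X Y c \<longleftrightarrow> S \<in> compact_ops Z Z \<and> P 0 \<circ> S \<circ> J 0 \<in> approximable_ops Y Y \<and>
    P 0 \<circ> S \<circ> diag c \<in> approximable_ops X Y"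
proof -
  have "(\<exists>T\<in>approximable_ops X Y. \<forall>x\<in>carr X.
      limitin (ntop Y) (\<lambda>n. \<Sum>r=1..n. scal Y (c r) (entry p X Y S 0 r x)) (T x) sequentially) \<longleftrightarrow>
    P 0 \<circ> S \<circ> diag c \<in> approximable_ops X Y" (is "?L \<longleftrightarrow> ?R") if S: "S \<in> compact_ops Z Z"
  proof -
    have R: "P 0 \<circ> S \<in> bounded_ops Z Y" by (rule row_bounded[OF compact_ops_bounded[OF S]])
    have lim: "limitin (ntop Y) (\<lambda>n. \<Sum>r=1..n. scal Y (c r) (entry p X Y S 0 r x))
        ((P 0 \<circ> S \<circ> diag c) x) sequentially" if "x \<in> carr X" for x
      using limitin_series_operator[OF R c that] by (simp add: entry_def)
    show ?thesis
    proof
      assume ?L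
      then obtain T where T: "T \<in> approximable_ops X Y"
        and "\<forall>x\<in>carr X. limitin (ntop Y) (\<lambda>n. \<Sum>r=1..n. scal Y (c r) (entry p X Y S 0 r x)) (T x) sequentially"
        by blast
      then have "\<forall>x\<in>carr X. T x = (P 0 \<circ> S \<circ> diag c) x"
        using lim Y.limitin_ntop_unique by blast
      then have "T = P 0 \<circ> S \<circ> diag c"
        using approximable_ops_bounded[OF X Y T] bounded_ops_comp[OF X Z diag_bounded[OF c] R]
        by (intro bounded_ops_eqI[of _ X Y]) auto
      then show ?R using T by simp
    next
      assume ?R
      then show ?L using lim by blast
    qed
  qed
  then show ?thesis unfolding I_seq_def by (auto simp: entry_def)
qed

lemma I_set_iff:
  "S \<in> I_set p X Y B \<longleftrightarrow> S \<in> compact_ops Z Z \<and> P 0 \<circ> S \<circ> J 0 \<in> approximable_ops Y Y \<and>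
    (\<forall>k\<in>B. P 0 \<circ> S \<circ> J k \<in> approximable_ops X Y)"
  by (simp add: I_set_def entry_def)

lemma I_seq_bounded: "I_seq p X Y c \<subseteq> bounded_ops Z Z"
  and I_set_bounded: "I_set p X Y B \<subseteq> bounded_ops Z Z"
  by (auto simp: I_seq_def I_set_def compact_ops_def)

text \<open>In matrix form: the zeroth row and the zeroth column of \<open>U\<close> are those of the identity.  This is what
  keeps conjugation by such \<open>U\<close> from touching the corner entry and from mixing other rows into the
  zeroth row.\<close>

definition fixes_Y :: "((nat \<Rightarrow> 'v) \<Rightarrow> (nat \<Rightarrow> 'v)) \<Rightarrow> bool" where
  "fixes_Y U \<longleftrightarrow> U \<in> bounded_ops Z Z \<and> (\<forall>z\<in>carr Z. U z 0 = z 0) \<and> (\<forall>y\<in>carr Y. U (J 0 y) = J 0 y)"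

lemma fixes_Y_bounded: "fixes_Y U \<Longrightarrow> U \<in> bounded_ops Z Z"
  by (simp add: fixes_Y_def)

lemma row_conjugate:
  assumes V: "fixes_Y V" and S: "S \<in> bounded_ops Z Z"
  shows "P 0 \<circ> (V \<circ> S \<circ> U) = P 0 \<circ> S \<circ> U"
proof
  fix z
  have "S (U z) \<in> carr Z" using bounded_ops_in'[OF Z S] .
  moreover from this have "V (S (U z)) \<in> carr Z" using V bounded_ops_in by (auto simp: fixes_Y_def)
  ultimately show "(P 0 \<circ> (V \<circ> S \<circ> U)) z = (P 0 \<circ> S \<circ> U) z"
    using V by (simp add: proj_apply fixes_Y_def)
qed

lemma conjugate_compact_and_corner:
  assumes U: "fixes_Y U" and V: "fixes_Y V" and S: "S \<in> compact_ops Z Z"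
    and corner: "P 0 \<circ> S \<circ> J 0 \<in> approximable_ops Y Y"
  shows "V \<circ> S \<circ> U \<in> compact_ops Z Z" and "P 0 \<circ> (V \<circ> S \<circ> U) \<circ> J 0 \<in> approximable_ops Y Y"
proof -
  show "V \<circ> S \<circ> U \<in> compact_ops Z Z"
    using U V S by (intro compact_ops_comp[OF Z Z Z Z]) (auto simp: fixes_Y_def)
  have "U \<circ> J 0 = J 0"
  proof
    fix y
    show "(U \<circ> J 0) y = J 0 y"
    proof (cases "y \<in> carr Y")
      case False
      then have "J 0 y = 0" by (simp add: Z_incl_def fun_eq_iff)
      moreover have "U 0 = 0"
        by (rule linear_map_zero[OF Z bounded_ops_linear[OF fixes_Y_bounded[OF U]]])
      ultimately show ?thesis by (simp only: comp_apply)
    qed (use U in \<open>simp add: fixes_Y_def\<close>)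
  qed
  moreover have "P 0 \<circ> (V \<circ> S \<circ> U) \<circ> J 0 = P 0 \<circ> S \<circ> (U \<circ> J 0)"
    unfolding row_conjugate[OF V compact_ops_bounded[OF S]] by (rule comp_assoc)
  ultimately show "P 0 \<circ> (V \<circ> S \<circ> U) \<circ> J 0 \<in> approximable_ops Y Y" using corner by simp
qed

section \<open>Shears, and the algebras given by a scalar sequence\<close>

definition shear :: "nat \<Rightarrow> (nat \<Rightarrow> 'k) \<Rightarrow> (nat \<Rightarrow> 'v) \<Rightarrow> nat \<Rightarrow> 'v" where
  "shear j b = (\<lambda>z. if z \<in> carr Z then z else 0) + (diag b \<circ> P j)"

lemma shear_apply:
  assumes "z \<in> carr Z" "0 < j"
  shows "shear j b z i = (if i = 0 then z 0 else z i + scal X (b i) (z j))"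
  using assms Z_coord[OF assms(1), of j] by (simp add: shear_def diag_def proj_apply)

lemma shear_fixes_Y:
  assumes b: "b \<in> ell1" and j: "0 < j"
  shows "fixes_Y (shear j b)"
  unfolding fixes_Y_def
proof (intro conjI ballI)
  show "shear j b \<in> bounded_ops Z Z"
    unfolding shear_def using proj_bounded[of j] diag_bounded[OF b] j
    by (intro bounded_ops_add[OF Z Z] id_bounded_op[OF Z] bounded_ops_comp[OF Z X]) auto
  show "shear j b z 0 = z 0" if "z \<in> carr Z" for z
    using shear_apply[OF that j] by simp
  show "shear j b (J 0 y) = J 0 y" for y
    unfolding fun_eq_iff shear_apply[OF incl_in(1) j] using j by (simp add: Z_incl_def)
qed

text \<open>The \<open>j\<close>-th coordinate of \<open>shear j b z\<close> is \<open>(1 + b\<^sub>j) z\<^sub>j\<close>, so the perturbation \<open>b z\<^sub>j\<close> can be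
  subtracted again by the shear with \<open>b' = - b / (1 + b\<^sub>j)\<close>.\<close>

lemma shear_inverse:
  assumes b: "b \<in> ell1" and j: "0 < j" and b': "\<And>i. b' i * (1 + b j) = - b i" and z: "z \<in> carr Z"
  shows "shear j b' (shear j b z) = z"
proof
  fix i
  have w: "shear j b z \<in> carr Z"
    by (rule bounded_ops_in[OF fixes_Y_bounded[OF shear_fixes_Y[OF b j]] z])
  have "scal X (b' i) (z j + scal X (b j) (z j)) = scal X (b' i * (1 + b j)) (z j)"
    by (simp add: X.scale_right_distrib X.scale_left_distrib distrib_left)
  then show "shear j b' (shear j b z) i = z i"
    using j by (simp add: shear_apply[OF w j] shear_apply[OF z j] b')
qed

lemma ell1_add: "b \<in> ell1 \<Longrightarrow> c \<in> ell1 \<Longrightarrow> (\<lambda>i. b i + c i :: 'k) \<in> ell1"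
  unfolding ell1_def mem_Collect_eq
  by (rule Infinite_Sum.abs_summable_on_comparison_test'[where g = "\<lambda>i. norm (b i) + norm (c i)"])
    (auto intro: summable_on_add norm_triangle_ineq)

lemma ell1_cmult: "b \<in> ell1 \<Longrightarrow> (\<lambda>i. b i * a :: 'k) \<in> ell1"
  unfolding ell1_def by (simp add: norm_mult summable_on_cmult_left)

lemma ell1_finite:
  assumes "finite A"
  shows "(\<lambda>i. if i \<in> A then a i else 0 :: 'k) \<in> ell1"
proof -
  have "(\<lambda>i. norm (if i \<in> A then a i else 0)) summable_on ({1..} \<inter> A)"
    using assms by (intro summable_on_finite) auto
  then show ?thesis
    unfolding ell1_def mem_Collect_eq
    by (rule summable_on_cong_neutral[THEN iffD1, rotated -1]) auto
qed

text \<open>The shear with \<open>b = c - e\<^sub>j\<close> takes the \<open>j\<close>-th inclusion to \<open>diag c\<close>; here \<open>1 + b\<^sub>j = c\<^sub>j\<close>, so it is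
  invertible exactly when \<open>j\<close> is in the support of \<open>c\<close>.\<close>

lemma conjugate_I_seq_I_set:
  assumes c: "c \<in> ell1" and j: "j \<in> supp c"
  shows "conjugate_sets Z (I_seq p X Y c) (I_set p X Y {j})"
proof -
  have j0: "0 < j" and cj: "c j \<noteq> 0" using j by (auto simp: supp_def)
  define b where "b = (\<lambda>i. c i + (if i \<in> {j} then - 1 else 0))"
  define b' where "b' = (\<lambda>i. b i * (- 1 / c j))"
  have b: "b \<in> ell1" unfolding b_def by (intro ell1_add c ell1_finite) simp
  have b': "b' \<in> ell1" unfolding b'_def by (intro ell1_cmult b)
  define U where "U = shear j b"
  define V where "V = shear j b'"
  have U: "fixes_Y U" and V: "fixes_Y V"
    unfolding U_def V_def using shear_fixes_Y[OF b j0] shear_fixes_Y[OF b' j0] by auto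
  have 1: "b' i * (1 + b j) = - b i" for i using cj by (simp add: b'_def b_def)
  have 2: "b i * (1 + b' j) = - b' i" for i using cj by (simp add: b'_def b_def field_simps)
  have VU: "V (U z) = z" and UV: "U (V z) = z" if "z \<in> carr Z" for z
    unfolding U_def V_def using shear_inverse[OF b j0 1 that] shear_inverse[OF b' j0 2 that] by auto
  have UJ: "U (J j x) = diag c x" for x
  proof
    fix i show "U (J j x) i = diag c x i"
      unfolding U_def shear_apply[OF incl_in(1) j0]
      using j0 by (auto simp: Z_incl_def diag_def b_def X.scale_left_distrib X.scale_left_diff_distrib)
  qed
  then have UJ': "U \<circ> J j = diag c" by auto
  have VD: "V \<circ> diag c = J j" using UJ VU[OF incl_in(1)] by (auto simp flip: UJ)
  show ?thesis
  proof (rule conjugate_setsI[of U _ V])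
    show "U \<in> bounded_ops Z Z" "V \<in> bounded_ops Z Z" using U V by (auto simp: fixes_Y_def)
    show "U (V z) = z" "V (U z) = z" if "z \<in> carr Z" for z using UV VU that by auto
    show "V \<circ> S \<circ> U \<in> I_set p X Y {j}" if "S \<in> I_seq p X Y c" for S
    proof -
      have S: "S \<in> compact_ops Z Z" "P 0 \<circ> S \<circ> J 0 \<in> approximable_ops Y Y"
        "P 0 \<circ> S \<circ> diag c \<in> approximable_ops X Y" using that I_seq_iff[OF c] by auto
      have "P 0 \<circ> (V \<circ> S \<circ> U) \<circ> J j = P 0 \<circ> S \<circ> diag c"
        unfolding row_conjugate[OF V compact_ops_bounded[OF S(1)]] by (simp add: comp_assoc UJ')
      then show ?thesis
        using conjugate_compact_and_corner[OF U V S(1,2)] S(3) by (simp add: I_set_iff)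
    qed
    show "U \<circ> S \<circ> V \<in> I_seq p X Y c" if "S \<in> I_set p X Y {j}" for S
    proof -
      have S: "S \<in> compact_ops Z Z" "P 0 \<circ> S \<circ> J 0 \<in> approximable_ops Y Y"
        "P 0 \<circ> S \<circ> J j \<in> approximable_ops X Y" using that by (auto simp: I_set_iff)
      have "P 0 \<circ> (U \<circ> S \<circ> V) \<circ> diag c = P 0 \<circ> S \<circ> J j"
        unfolding row_conjugate[OF U compact_ops_bounded[OF S(1)]] by (simp add: comp_assoc VD)
      then show ?thesis
        using conjugate_compact_and_corner[OF V U S(1,2)] S(3) by (simp add: I_seq_iff[OF c])
    qed
  qed
qed

end

section \<open>Permuting blocks when \<open>X\<close> is isomorphic to the sum of its copies\<close>

locale Z_sum_self_similar = Z_sum p X Y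
  for p :: real and X Y :: "('k::real_normed_field, 'v::ab_group_add) nspace" +
  fixes f :: "(nat \<Rightarrow> 'v) \<Rightarrow> 'v" and g :: "'v \<Rightarrow> nat \<Rightarrow> 'v"
  assumes f: "f \<in> bounded_ops (lp_sum p {1..} (\<lambda>j. X)) X"
    and g: "g \<in> bounded_ops X (lp_sum p {1..} (\<lambda>j. X))"
    and gf: "\<And>x. x \<in> carr (lp_sum p {1..} (\<lambda>j. X)) \<Longrightarrow> g (f x) = x"
    and fg: "\<And>y. y \<in> carr X \<Longrightarrow> f (g y) = y"
begin

abbreviation "LX \<equiv> lp_sum p {1::nat..} (\<lambda>j. X)"
abbreviation "N2 \<equiv> {1::nat..} \<times> {1::nat..}"

sublocale lx: lp_sequence p "{1..}" "\<lambda>j. X"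
  by unfold_locales (use p X in auto)

lemma LX: "normed_space LX"
  by (rule lx.normed_space_lp)

text \<open>With \<open>w (m, i) = g (z m) i\<close>, the vector \<open>z\<close> becomes a double sequence in \<open>X\<close>; \<open>block_row t z m\<close> is
  row \<open>m\<close> of its rearrangement \<open>w \<circ> t\<close>.\<close>

definition block_row :: "(nat \<times> nat \<Rightarrow> nat \<times> nat) \<Rightarrow> (nat \<Rightarrow> 'v) \<Rightarrow> nat \<Rightarrow> nat \<Rightarrow> 'v" where
  "block_row t z m = (\<lambda>i. if 1 \<le> i then g (z (fst (t (m, i)))) (snd (t (m, i))) else 0)"

definition block_permute :: "(nat \<times> nat \<Rightarrow> nat \<times> nat) \<Rightarrow> (nat \<Rightarrow> 'v) \<Rightarrow> nat \<Rightarrow> 'v" where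
  "block_permute t z = (\<lambda>m. if z \<notin> carr Z then 0 else if m = 0 then z 0 else f (block_row t z m))"

lemma Z_coord_X: "z \<in> carr Z \<Longrightarrow> 1 \<le> m \<Longrightarrow> z m \<in> carr X"
  using Z_coord[of z m] by simp

lemma bij_N2:
  assumes "bij_betw t N2 N2" "1 \<le> m" "1 \<le> i"
  shows "1 \<le> fst (t (m, i))" "1 \<le> snd (t (m, i))"
  using bij_betw_apply[OF assms(1), of "(m, i)"] assms(2,3) by (auto simp: mem_Times_iff)

text \<open>The double sequence \<open>w\<close> is \<open>p\<close>-summable over \<open>\<nat> \<times> \<nat>\<close> with sum at most \<open>C\<^sup>p \<parallel>z\<parallel>\<^sup>p\<close>.  Unconditional
  summation lets \<open>t\<close> permute the terms, and summing the result by rows gives both claims.\<close>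

lemma block_rows_summable:
  assumes t: "bij_betw t N2 N2" and z: "z \<in> carr Z"
    and C: "0 < C" "\<And>x. x \<in> carr X \<Longrightarrow> nrm LX (g x) \<le> C * nrm X x"
  shows "\<And>m. 1 \<le> m \<Longrightarrow> block_row t z m \<in> carr LX"
    and "\<And>F. finite F \<Longrightarrow> F \<subseteq> {1..} \<Longrightarrow> (\<Sum>m\<in>F. nrm LX (block_row t z m) powr p) \<le> (C * nrm Z z) powr p"
proof -
  define h where "h q = nrm X (g (z (fst q)) (snd q)) powr p" for q
  have zX: "z m \<in> carr X" if "1 \<le> m" for m using Z_coord_X[OF z that] .
  have gz: "g (z m) \<in> carr LX" if "1 \<le> m" for m using bounded_ops_in[OF g zX[OF that]] .
  have row: "((\<lambda>i. h (m, i)) has_sum nrm LX (g (z m)) powr p) {1..}" if "m \<in> {1..}" for m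
    unfolding lx.lp_nrm_powr h_def fst_conv snd_conv
    using has_sum_infsum[OF lx.lp_summable[OF gz]] that by simp
  have le: "nrm LX (g (z m)) powr p \<le> C powr p * nrm (Zc m) (z m) powr p" if "m \<in> {1..}" for m
  proof -
    have "nrm LX (g (z m)) powr p \<le> (C * nrm X (z m)) powr p"
      using p C(2)[OF zX] that lx.lp_nrm_nonneg by (intro powr_mono2) auto
    then show ?thesis using that C(1) X.nrm_nonneg[OF zX] by (simp add: powr_mult)
  qed
  have sZ: "(\<lambda>m. C powr p * nrm (Zc m) (z m) powr p) summable_on {1..}"
    by (intro summable_on_cmult_right summable_on_subset_banach[OF Z_summable[OF z]]) simp
  have sg: "(\<lambda>m. nrm LX (g (z m)) powr p) summable_on {1..}"
    by (rule summable_on_comparison_test[OF sZ le]) auto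
  have sh: "h summable_on N2"
    by (rule summable_on_SigmaI[OF row sg]) (auto simp: h_def)
  have sum_h: "infsum h N2 \<le> (C * nrm Z z) powr p"
  proof -
    have "infsum h N2 = (\<Sum>\<^sub>\<infinity>m\<in>{1..}. \<Sum>\<^sub>\<infinity>i\<in>{1..}. h (m, i))"
      by (rule infsum_Sigma_banach[OF sh, symmetric])
    also have "\<dots> = (\<Sum>\<^sub>\<infinity>m\<in>{1..}. nrm LX (g (z m)) powr p)"
      by (rule infsum_cong) (use row infsumI in blast)
    also have "\<dots> \<le> (\<Sum>\<^sub>\<infinity>m\<in>{1..}. C powr p * nrm (Zc m) (z m) powr p)"
      by (rule infsum_mono[OF sg sZ le])
    also have "\<dots> \<le> (\<Sum>\<^sub>\<infinity>m\<in>UNIV. C powr p * nrm (Zc m) (z m) powr p)"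
      by (rule infsum_mono_neutral[OF sZ summable_on_cmult_right[OF Z_summable[OF z]]]) auto
    also have "\<dots> = (C * nrm Z z) powr p"
      using C(1) Z_nrm_nonneg
      by (simp add: infsum_cmult_right[OF Z_summable[OF z]] Z_nrm_powr powr_mult)
    finally show ?thesis .
  qed
  have st: "(\<lambda>q. h (t q)) summable_on N2"
    using sh summable_on_reindex_bij_betw[OF t, of h] by simp
  have st': "(\<lambda>(m, i). h (t (m, i))) summable_on N2"
    using st by (simp only: case_prod_unfold prod.collapse)
  have rows: "(\<lambda>i. h (t (m, i))) summable_on {1..}" if "1 \<le> m" for m
    by (rule summable_on_SigmaD1[OF st']) (use that in simp)
  have h_eq: "nrm X (block_row t z m i) powr p = h (t (m, i))" if "1 \<le> i" for m i
    using that by (simp add: block_row_def h_def)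
  show in_LX: "block_row t z m \<in> carr LX" if m: "1 \<le> m" for m
  proof -
    have "block_row t z m i \<in> carr X" if "1 \<le> i" for i
      using that bij_N2[OF t m that] lx.lp_coord[OF gz] by (simp add: block_row_def)
    moreover have "(\<lambda>i. nrm X (block_row t z m i) powr p) summable_on {1..}"
      using rows[OF m] by (rule summable_on_cong[THEN iffD1, rotated]) (simp add: h_eq)
    ultimately show ?thesis by (auto simp: lp_sum_def) (simp add: block_row_def)
  qed
  fix F :: "nat set" assume F: "finite F" "F \<subseteq> {1..}"
  have nrm_row: "nrm LX (block_row t z m) powr p = (\<Sum>\<^sub>\<infinity>i\<in>{1..}. h (t (m, i)))" for m
    unfolding lx.lp_nrm_powr by (rule infsum_cong) (simp add: h_eq)
  have "(\<Sum>m\<in>F. nrm LX (block_row t z m) powr p) \<le> (\<Sum>\<^sub>\<infinity>m\<in>{1..}. \<Sum>\<^sub>\<infinity>i\<in>{1..}. h (t (m, i)))"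
    unfolding nrm_row
  proof (rule finite_sum_le_infsum[OF _ F])
    show "(\<lambda>m. \<Sum>\<^sub>\<infinity>i\<in>{1..}. h (t (m, i))) summable_on {1..}"
      by (rule summable_on_Sigma_banach[OF st'])
  qed (auto intro!: infsum_nonneg simp: h_def)
  also have "\<dots> = infsum (\<lambda>q. h (t q)) N2"
    by (rule infsum_Sigma_banach[OF st])
  also have "\<dots> = infsum h N2" by (rule infsum_reindex_bij_betw[OF t])
  finally show "(\<Sum>m\<in>F. nrm LX (block_row t z m) powr p) \<le> (C * nrm Z z) powr p"
    using sum_h by linarith
qed

lemma block_row_in: "bij_betw t N2 N2 \<Longrightarrow> z \<in> carr Z \<Longrightarrow> 1 \<le> m \<Longrightarrow> block_row t z m \<in> carr LX"
  using bounded_ops_bound[OF X g] block_rows_summable(1) by blast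

lemma block_permute_bounded:
  assumes t: "bij_betw t N2 N2"
  shows "block_permute t \<in> bounded_ops Z Z"
proof -
  obtain C where C: "C > 0" "\<forall>x\<in>carr X. nrm LX (g x) \<le> C * nrm X x"
    using bounded_ops_bound[OF X g] by blast
  obtain D where D: "D > 0" "\<forall>x\<in>carr LX. nrm X (f x) \<le> D * nrm LX x"
    using bounded_ops_bound[OF LX f] by blast
  have row: "block_row t z m \<in> carr LX" if "z \<in> carr Z" "1 \<le> m" for z m
    using block_row_in[OF t that] .
  have pos: "1 \<le> m" if "m \<noteq> 0" for m :: nat using that by simp
  have in_comp: "block_permute t z m \<in> carr (Zc m)" if z: "z \<in> carr Z" for z m
    using Z_coord[OF z, of 0] bounded_ops_in[OF f row[OF z, of m]]
    by (cases "m = 0") (simp_all add: block_permute_def z)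
  have le: "(\<Sum>m\<in>F. nrm (Zc m) (block_permute t z m) powr p) \<le> ((1 + D * C) * nrm Z z) powr p"
    if z: "z \<in> carr Z" and F: "finite F" for z F
  proof -
    let ?F = "F - {0}"
    have "(\<Sum>m\<in>F. nrm (Zc m) (block_permute t z m) powr p) \<le>
        (\<Sum>m\<in>insert 0 ?F. nrm (Zc m) (block_permute t z m) powr p)"
      using F by (intro sum_mono2) auto
    also have "\<dots> = nrm Y (z 0) powr p + (\<Sum>m\<in>?F. nrm X (f (block_row t z m)) powr p)"
      by (subst sum.insert) (use F z in \<open>auto simp: block_permute_def intro!: sum.cong\<close>)
    also have "(\<Sum>m\<in>?F. nrm X (f (block_row t z m)) powr p) \<le>
        (\<Sum>m\<in>?F. D powr p * nrm LX (block_row t z m) powr p)"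
    proof (rule sum_mono)
      fix m assume "m \<in> ?F"
      then have m: "1 \<le> m" by auto
      have "nrm X (f (block_row t z m)) powr p \<le> (D * nrm LX (block_row t z m)) powr p"
        using p D(2) row[OF z m] bounded_ops_in[OF f] by (intro powr_mono2 X.nrm_nonneg) auto
      then show "nrm X (f (block_row t z m)) powr p \<le> D powr p * nrm LX (block_row t z m) powr p"
        using D(1) lx.lp_nrm_nonneg by (simp add: powr_mult)
    qed
    also have "\<dots> = D powr p * (\<Sum>m\<in>?F. nrm LX (block_row t z m) powr p)"
      by (simp add: sum_distrib_left)
    also have "\<dots> \<le> D powr p * (C * nrm Z z) powr p"
      using C(2) F by (intro mult_left_mono block_rows_summable(2)[OF t z C(1)]) auto
    also have "\<dots> = (D * (C * nrm Z z)) powr p"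
      using C(1) D(1) Z_nrm_nonneg by (simp add: powr_mult)
    also have "nrm Y (z 0) powr p \<le> nrm Z z powr p"
      using p Z_coord_le[OF z, of 0] Z_coord[OF z, of 0] by (intro powr_mono2 Y.nrm_nonneg) auto
    also have "nrm Z z powr p + (D * (C * nrm Z z)) powr p \<le> (nrm Z z + D * (C * nrm Z z)) powr p"
      using sum_powr_le_powr_sum[of p "\<lambda>b. if b then nrm Z z else D * (C * nrm Z z)" UNIV]
        p C(1) D(1) Z_nrm_nonneg by (simp add: UNIV_bool add.commute)
    finally show ?thesis by (simp add: algebra_simps)
  qed
  have bound: "block_permute t z \<in> carr Z \<and> nrm Z (block_permute t z) \<le> (1 + D * C) * nrm Z z"
    if z: "z \<in> carr Z" for z
    using ZI[of "block_permute t z", OF in_comp[OF z] _ le[OF z]] C(1) D(1) Z_nrm_nonneg by simp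
  show ?thesis
  proof (rule bounded_opsI)
    show "linear_map Z Z (block_permute t)"
      unfolding linear_map_def
    proof (intro conjI ballI allI)
      show "block_permute t \<in> carr Z \<rightarrow> carr Z" using bound by blast
      note g_add = linear_map_add[OF bounded_ops_linear[OF g]]
        and g_scal = linear_map_scal[OF bounded_ops_linear[OF g]]
      show "block_permute t (z + w) = block_permute t z + block_permute t w"
        if z: "z \<in> carr Z" and w: "w \<in> carr Z" for z w
      proof
        fix m
        show "block_permute t (z + w) m = (block_permute t z + block_permute t w) m"
        proof (cases "m = 0")
          case False
          then have m: "1 \<le> m" by simp
          have "block_row t (z + w) m = block_row t z m + block_row t w m"
            using bij_N2[OF t m] z w by (auto simp: block_row_def fun_eq_iff g_add Z_coord_X)
          then have "f (block_row t (z + w) m) = f (block_row t z m) + f (block_row t w m)"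
            using linear_map_add[OF bounded_ops_linear[OF f] row[OF z m] row[OF w m]] by metis
          then show ?thesis using False z w Z.add_in[OF z w] by (simp add: block_permute_def)
        qed (use z w Z.add_in[OF z w] in \<open>simp add: block_permute_def\<close>)
      qed
      show "block_permute t (scal Z a z) = scal Z a (block_permute t z)" if z: "z \<in> carr Z" for a z
      proof
        fix m
        show "block_permute t (scal Z a z) m = scal Z a (block_permute t z) m"
        proof (cases "m = 0")
          case False
          then have m: "1 \<le> m" by simp
          have g_az: "g (scal Z a z k) = (\<lambda>i. scal X a (g (z k) i))" if "1 \<le> k" for k
            using that g_scal[OF Z_coord_X[OF z that], of a, unfolded lx.scal_lp] by (simp add: scal_Z)
          have "block_row t (scal Z a z) m = scal LX a (block_row t z m)"
          proof
            fix i
            show "block_row t (scal Z a z) m i = scal LX a (block_row t z m) i"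
              unfolding block_row_def lx.scal_lp
              by (cases "1 \<le> i") (simp_all add: g_az[OF bij_N2(1)[OF t m]])
          qed
          then have "f (block_row t (scal Z a z) m) = scal X a (f (block_row t z m))"
            using linear_map_scal[OF bounded_ops_linear[OF f] row[OF z m]] by metis
          moreover have "scal Z a (block_permute t z) m = scal X a (block_permute t z m)"
            using False by (simp add: scal_Z)
          ultimately show ?thesis using False z Z.scal_in[OF z] by (simp add: block_permute_def)
        next
          case True
          then show ?thesis using z Z.scal_in[OF z]
            by (simp add: block_permute_def scal_Z)
        qed
      qed
    qed
    show "nrm Z (block_permute t z) \<le> (1 + D * C) * nrm Z z" if "z \<in> carr Z" for z
      using bound that by blast
  qed (simp add: block_permute_def fun_eq_iff)
qed

lemma block_permute_fixes_Y:
  assumes t: "bij_betw t N2 N2"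
  shows "fixes_Y (block_permute t)"
  unfolding fixes_Y_def
proof (intro conjI ballI)
  show "block_permute t \<in> bounded_ops Z Z" by (rule block_permute_bounded[OF t])
  show "block_permute t z 0 = z 0" if "z \<in> carr Z" for z using that by (simp add: block_permute_def)
  show "block_permute t (J 0 y) = J 0 y" if "y \<in> carr Y" for y
  proof
    fix m
    show "block_permute t (J 0 y) m = J 0 y m"
    proof (cases "m = 0")
      case False
      then have m: "1 \<le> m" by simp
      have "block_row t (J 0 y) m = (\<lambda>i. 0)"
        using bij_N2(1)[OF t m] linear_map_zero[OF X bounded_ops_linear[OF g]]
        by (fastforce simp: block_row_def Z_incl_def fun_eq_iff)
      then have "f (block_row t (J 0 y) m) = 0"
        using linear_map_zero[OF LX bounded_ops_linear[OF f]] by (simp add: zero_fun_def)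
      then show ?thesis using False incl_in(1)[of 0 y] by (simp add: block_permute_def) (simp add: Z_incl_def)
    qed (use incl_in(1)[of 0 y] in \<open>simp add: block_permute_def\<close>)
  qed
qed

text \<open>Since \<open>g\<close> undoes \<open>f\<close>, the rearrangements compose, and \<open>f\<close> puts each row together again.\<close>

lemma block_permute_inverse:
  assumes t: "bij_betw t N2 N2" and s: "bij_betw s N2 N2" and st: "\<And>q. q \<in> N2 \<Longrightarrow> s (t q) = q"
    and z: "z \<in> carr Z"
  shows "block_permute t (block_permute s z) = z"
proof
  fix m
  have w: "block_permute s z \<in> carr Z" by (rule bounded_ops_in[OF block_permute_bounded[OF s] z])
  show "block_permute t (block_permute s z) m = z m"
  proof (cases "m = 0")
    case False
    then have m: "1 \<le> m" by simp
    have gw: "g (block_permute s z k) = block_row s z k" if "1 \<le> k" for k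
      using that gf[OF block_row_in[OF s z that]] z by (simp add: block_permute_def)
    have "block_row t (block_permute s z) m i = g (z m) i" for i
    proof (cases "1 \<le> i")
      case True
      note k = bij_N2[OF t m True]
      have "block_row t (block_permute s z) m i = block_row s z (fst (t (m, i))) (snd (t (m, i)))"
        using True by (simp add: block_row_def[of t] gw[OF k(1)])
      also have "\<dots> = g (z (fst (s (t (m, i))))) (snd (s (t (m, i))))"
        using k(2) by (simp add: block_row_def)
      finally show ?thesis using st[of "(m, i)"] m True by simp
    next
      case False
      then show ?thesis
        using lx.lp_off[OF bounded_ops_in[OF g Z_coord_X[OF z m]], of i] by (simp add: block_row_def)
    qed
    then have "block_row t (block_permute s z) m = g (z m)" by blast
    then show ?thesis
      using False w fg[OF Z_coord_X[OF z m]] by (simp add: block_permute_def[of t])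
  qed (use z w in \<open>simp add: block_permute_def\<close>)
qed

text \<open>The double sequence of \<open>J k x\<close> vanishes outside row \<open>k\<close>, and row \<open>m\<close> of its rearrangement takes no
  term from there.\<close>

lemma block_permute_incl_supp:
  assumes m: "1 \<le> m" and maps: "\<And>i. 1 \<le> i \<Longrightarrow> fst (t (m, i)) \<noteq> k"
  shows "block_permute t (J k x) m = 0"
proof -
  have "block_row t (J k x) m = (\<lambda>i. 0)"
  proof
    fix i
    show "block_row t (J k x) m i = 0"
    proof (cases "1 \<le> i")
      case True
      then have "J k x (fst (t (m, i))) = 0" using maps[OF True] by (simp add: Z_incl_def)
      then show ?thesis
        using linear_map_zero[OF X bounded_ops_linear[OF g]] by (simp add: block_row_def)
    qed (simp add: block_row_def)
  qed
  then have "f (block_row t (J k x) m) = 0"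
    using linear_map_zero[OF LX bounded_ops_linear[OF f]] by (simp add: zero_fun_def)
  then show ?thesis using m by (simp add: block_permute_def)
qed

text \<open>By the condition on \<open>t\<close> the operator \<open>block_permute t\<close> maps the summands over \<open>C\<close> into the sum of
  those over \<open>B\<close>, where the zeroth row of \<open>S\<close> has approximable columns.\<close>

lemma block_permute_conjugates:
  assumes t: "bij_betw t N2 N2" and s: "bij_betw s N2 N2"
    and B: "B \<subseteq> {1..}" and C: "C \<subseteq> {1..}"
    and maps: "\<And>m i. 1 \<le> m \<Longrightarrow> 1 \<le> i \<Longrightarrow> fst (t (m, i)) \<in> C \<Longrightarrow> m \<in> B"
    and S: "S \<in> I_set p X Y B"
  shows "block_permute s \<circ> S \<circ> block_permute t \<in> I_set p X Y C"
proof -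
  let ?U = "block_permute t" and ?V = "block_permute s"
  have U: "fixes_Y ?U" and V: "fixes_Y ?V" using block_permute_fixes_Y t s by auto
  have S': "S \<in> compact_ops Z Z" "P 0 \<circ> S \<circ> J 0 \<in> approximable_ops Y Y"
    and cols: "\<And>k. k \<in> B \<Longrightarrow> P 0 \<circ> S \<circ> J k \<in> approximable_ops X Y"
    using S by (auto simp: I_set_iff)
  have "P 0 \<circ> (?V \<circ> S \<circ> ?U) \<circ> J k \<in> approximable_ops X Y" if k: "k \<in> C" for k
  proof -
    have k0: "0 < k" using k C by auto
    have "(P 0 \<circ> S) \<circ> (?U \<circ> J k) \<in> approximable_ops X Y"
    proof (rule column_operator_approximable[OF row_compact[OF S'(1)] _ _ cols])
      show "?U \<circ> J k \<in> bounded_ops X Z"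
        using bounded_ops_comp[OF X Z _ fixes_Y_bounded[OF U]] incl_bounded[of k] k0 by simp
      show "0 \<notin> B" using B by auto
      show "(?U \<circ> J k) x m = 0" if "m \<notin> B" for x m
      proof (cases "m = 0")
        case True
        then show ?thesis
          using U incl_in(1)[of k x] k0 by (simp add: fixes_Y_def) (simp add: Z_incl_def)
      next
        case False
        then have m: "1 \<le> m" by simp
        have "fst (t (m, i)) \<noteq> k" if "1 \<le> i" for i using maps[OF m that] k \<open>m \<notin> B\<close> by blast
        then show ?thesis using block_permute_incl_supp[OF m] by simp
      qed
    qed
    then show ?thesis unfolding row_conjugate[OF V compact_ops_bounded[OF S'(1)]] by (simp only: comp_assoc)
  qed
  then show ?thesis
    unfolding I_set_iff using conjugate_compact_and_corner[OF U V S'] by blast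
qed

text \<open>\<open>B \<times> \<nat>\<close> and \<open>C \<times> \<nat>\<close> are countably infinite, and so are their complements because \<open>B\<close> and \<open>C\<close> are
  proper subsets; hence a bijection of \<open>\<nat> \<times> \<nat>\<close> takes the first set onto the second, whatever the
  sizes of \<open>B\<close> and \<open>C\<close>.\<close>

lemma conjugate_I_set_I_set:
  assumes B: "B \<noteq> {}" "B \<subset> {1..}" and C: "C \<noteq> {}" "C \<subset> {1..}"
  shows "conjugate_sets Z (I_set p X Y B) (I_set p X Y C)"
proof -
  let ?N = "{1::nat..}"
  have bij: "\<exists>h. bij_betw h (D \<times> ?N) (E \<times> ?N)" if "D \<noteq> {}" "E \<noteq> {}" for D E :: "nat set"
  proof -
    have inf: "infinite (Q \<times> ?N)" if "Q \<noteq> {}" for Q :: "nat set"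
      using that infinite_Ici[of "1::nat"] by (auto dest: finite_cartesian_productD2)
    have "bij_betw (to_nat_on (D \<times> ?N)) (D \<times> ?N) UNIV"
      by (rule to_nat_on_infinite) (use inf that in auto)
    moreover have "bij_betw (from_nat_into (E \<times> ?N)) UNIV (E \<times> ?N)"
      by (rule bij_betw_from_nat_into) (use inf that in auto)
    ultimately show ?thesis using bij_betw_trans by blast
  qed
  obtain h where h: "bij_betw h (B \<times> ?N) (C \<times> ?N)" using bij[OF B(1) C(1)] by blast
  have co: "?N - B \<noteq> {}" "?N - C \<noteq> {}" using B(2) C(2) by auto
  obtain k where k: "bij_betw k ((?N - B) \<times> ?N) ((?N - C) \<times> ?N)" using bij[OF co] by blast
  define t where "t q = (if q \<in> B \<times> ?N then h q else k q)" for q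
  have N2: "B \<times> ?N \<union> (?N - B) \<times> ?N = N2" "C \<times> ?N \<union> (?N - C) \<times> ?N = N2"
    using B(2) C(2) by auto
  have t: "bij_betw t N2 N2"
    using bij_betw_disjoint_Un[OF h k] unfolding N2 t_def by auto
  have t_C: "fst (t (m, i)) \<in> C \<longleftrightarrow> m \<in> B" if "1 \<le> m" "1 \<le> i" for m i
    using bij_betw_apply[OF h, of "(m, i)"] bij_betw_apply[OF k, of "(m, i)"] that
    by (auto simp: t_def mem_Times_iff)
  define s where "s = inv_into N2 t"
  have s: "bij_betw s N2 N2" unfolding s_def by (rule bij_betw_inv_into[OF t])
  have st: "s (t q) = q" and ts: "t (s q) = q" if "q \<in> N2" for q
    using that t bij_betw_inv_into_left[OF t] bij_betw_inv_into_right[OF t] by (auto simp: s_def)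
  have s_B: "m \<in> C" if "1 \<le> m" "1 \<le> i" "fst (s (m, i)) \<in> B" for m i
  proof -
    obtain m' i' where q: "s (m, i) = (m', i')" by force
    have "1 \<le> m'" "1 \<le> i'" using bij_N2[OF s that(1,2)] by (simp_all add: q)
    then show ?thesis using t_C[of m' i'] ts[of "(m, i)"] that by (simp add: q)
  qed
  show ?thesis
  proof (rule conjugate_setsI[of "block_permute t" _ "block_permute s"])
    show "block_permute t \<in> bounded_ops Z Z" "block_permute s \<in> bounded_ops Z Z"
      using block_permute_bounded t s by auto
    show "block_permute t (block_permute s z) = z" "block_permute s (block_permute t z) = z"
      if "z \<in> carr Z" for z
      using block_permute_inverse[OF t s st that] block_permute_inverse[OF s t ts that] by auto
    show "block_permute s \<circ> S \<circ> block_permute t \<in> I_set p X Y C" if "S \<in> I_set p X Y B" for S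
      by (rule block_permute_conjugates[OF t s _ _ _ that]) (use B C t_C in auto)
    show "block_permute t \<circ> S \<circ> block_permute s \<in> I_set p X Y B" if "S \<in> I_set p X Y C" for S
      by (rule block_permute_conjugates[OF s t _ _ _ that]) (use B C s_B in auto)
  qed
qed

end

section \<open>Isomorphisms between the algebras\<close>

theorem theorem3p4:
  fixes X Y :: "('k::real_normed_field, 'v::ab_group_add) nspace" and p :: real
  assumes "banach_space X" and "banach_space Y"
    and "approximation_property X" and "\<not> approximation_property (dual X)"
    and "approximable_ops X Y \<subset> compact_ops X Y"
    and "1 < p"
  shows "(\<forall>c\<in>ell1. \<forall>d\<in>ell1. supp c \<noteq> {} \<and> supp d \<noteq> {} \<longrightarrow>
            algebra_isomorphic (Z_space p X Y) (I_seq p X Y c) (I_seq p X Y d)) \<and>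
         (\<forall>c\<in>ell1. supp c \<noteq> {} \<longrightarrow> (\<forall>j\<in>supp c.
            algebra_isomorphic (Z_space p X Y) (I_seq p X Y c) (I_set p X Y {j}))) \<and>
         (linearly_isomorphic (lp_sum p {1::nat..} (\<lambda>j. X)) X \<longrightarrow>
            (\<forall>\<I>\<in>F_plus_family p X Y. \<forall>\<J>\<in>F_family p X Y.
               algebra_isomorphic (Z_space p X Y) \<I> \<J>))"
proof -
  interpret Z_sum p X Y
    by (rule Z_sum.intro[OF assms(6) banach_space.axioms(1)[OF assms(1)] banach_space.axioms(1)[OF assms(2)]])
  note iso = conjugate_imp_algebra_isomorphic[OF Z]
  have seq_set: "conjugate_sets Z (I_seq p X Y c) (I_set p X Y {j})" if "c \<in> ell1" "j \<in> supp c" for c j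
    using conjugate_I_seq_I_set[OF that] .
  have set_set: "conjugate_sets Z (I_set p X Y {j}) (I_set p X Y {k})" if "1 \<le> j" "1 \<le> k" for j k
  proof -
    \<comment> \<open>Both singletons are conjugate to \<open>I_seq\<close> of one sequence with \<open>j\<close> and \<open>k\<close> in its support.\<close>
    define e :: "nat \<Rightarrow> 'k" where "e = (\<lambda>i. if i \<in> {j, k} then 1 else 0)"
    have e: "e \<in> ell1" unfolding e_def by (rule ell1_finite) simp
    have "j \<in> supp e" "k \<in> supp e" using that by (auto simp: e_def supp_def)
    then show ?thesis
      using conjugate_sets_trans[OF Z conjugate_sets_sym[OF seq_set[OF e]] seq_set[OF e]] by blast
  qed
  show ?thesis
  proof (intro conjI ballI impI)
    fix c d :: "nat \<Rightarrow> 'k" assume c: "c \<in> ell1" and d: "d \<in> ell1" and "supp c \<noteq> {} \<and> supp d \<noteq> {}"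
    then obtain j k where j: "j \<in> supp c" and k: "k \<in> supp d" by blast
    then have "1 \<le> j" "1 \<le> k" by (auto simp: supp_def)
    then have "conjugate_sets Z (I_seq p X Y c) (I_set p X Y {k})"
      using conjugate_sets_trans[OF Z seq_set[OF c j] set_set] by blast
    then have "conjugate_sets Z (I_seq p X Y c) (I_seq p X Y d)"
      using conjugate_sets_trans[OF Z _ conjugate_sets_sym[OF seq_set[OF d k]]] by blast
    then show "algebra_isomorphic Z (I_seq p X Y c) (I_seq p X Y d)"
      by (rule iso[OF I_seq_bounded I_seq_bounded])
  next
    fix c :: "nat \<Rightarrow> 'k" and j assume "c \<in> ell1" "j \<in> supp c"
    then show "algebra_isomorphic Z (I_seq p X Y c) (I_set p X Y {j})"
      by (rule iso[OF I_seq_bounded I_set_bounded seq_set])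
  next
    fix \<I> \<J>
    assume X_iso: "linearly_isomorphic (lp_sum p {1::nat..} (\<lambda>j. X)) X"
      and I_in: "\<I> \<in> F_plus_family p X Y" and J_in: "\<J> \<in> F_family p X Y"
    obtain c where c: "c \<in> ell1" "infinite (supp c) \<or> 2 \<le> card (supp c)" and I: "\<I> = I_seq p X Y c"
      using I_in unfolding F_plus_family_def by blast
    obtain B where B: "B \<noteq> {}" "B \<subset> {1..}" and J: "\<J> = I_set p X Y B"
      using J_in unfolding F_family_def by blast
    have "supp c \<noteq> {}" using c(2) by auto
    obtain h where "linear_homeomorphism (lp_sum p {1::nat..} (\<lambda>j. X)) X h"
      using X_iso unfolding linearly_isomorphic_def by blast
    moreover have "normed_space (lp_sum p {1::nat..} (\<lambda>j. X))"
      by (rule lp_family.normed_space_lp) (unfold_locales, use p X in auto)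
    ultimately obtain f g where fg: "f \<in> bounded_ops (lp_sum p {1::nat..} (\<lambda>j. X)) X"
      "g \<in> bounded_ops X (lp_sum p {1::nat..} (\<lambda>j. X))"
      "\<And>x. x \<in> carr (lp_sum p {1::nat..} (\<lambda>j. X)) \<Longrightarrow> g (f x) = x"
      "\<And>y. y \<in> carr X \<Longrightarrow> f (g y) = y"
      using linear_homeomorphism_bounded_inverse[OF _ X] by blast
    interpret Z_sum_self_similar p X Y f g
      by unfold_locales (fact fg)+
    obtain j where j: "j \<in> supp c" using \<open>supp c \<noteq> {}\<close> by blast
    have "{j} \<subset> {1..}"
    proof
      show "{j} \<subseteq> {1..}" using j by (auto simp: supp_def)
      show "{j} \<noteq> {1..}" using infinite_Ici[of "1::nat"] by (metis finite.emptyI finite.insertI)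
    qed
    then have "conjugate_sets Z \<I> \<J>"
      unfolding I J
      using conjugate_sets_trans[OF Z seq_set[OF c(1) j] conjugate_I_set_I_set[OF _ _ B]] by blast
    then show "algebra_isomorphic Z \<I> \<J>"
      unfolding I J by (rule iso[OF I_seq_bounded I_set_bounded])
  qed
qed

end
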